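(* Fix $b>0$. For every real $s>0$ with $s\notin\mathcal P$, $$\widetilde Z_b(s)=\big(\mathcal R(AF_b^{H_b})\big)(s),$$ where the matrix $H_b$ satisfies the compatibility condition $H_b=\mathcal C_b(H_b)$ (the map $\mathcal C_b$ being defined when $z_i/p_i\notin\mathcal P$ for every $i\in E$), and the series defining the right-hand side converges absolutely. At points $s\in\mathcal P$ the apparent singularities of the right-hand side are removable, and the identity extends by continuity: $\lim_{r\to s,\ r>0,\ r\notin\mathcal P}\big(\mathcal R(AF_b^{H_b})\big)(r)=\widetilde Z_b(s)$.
   Context: Model. Let $E=\{1,\dots,m\}$; for each $i\in E$ let $c_i>0$, $\lambda_i>0$, $p_i\in(0,1)$, and let $Q=(q_{ij})_{i,j\in E}$ be a stochastic matrix. $(X,J)$ is the Markov process on $[0,\infty)\times E$ with the following dynamics: while the phase $J$ equals $i$, the level $X$ increases linearly with slope $1/c_i$ and the next jump occurs at rate $\lambda_i$; at a jump from $(x,i)$ the process moves to $(p_i x,j)$ with probability $q_{ij}$ ($j=i$ is allowed). $\mathbb E_{x,i}$ denotes expectation given $(X(0),J(0))=(x,i)$. Fix $w>0$; put $z_i=c_i(\lambda_i+w)$, $\gamma_i=c_i\lambda_i/p_i$. Let $\tau_{\downarrow b}=\inf\{t\ge0:X(t)\le b\}$, let $Z^{\downarrow}(x,b)$ be the matrix with entries $\mathbb E_{x,i}[e^{-w\tau_{\downarrow b}};J(\tau_{\downarrow b})=j]$ (contribution of $\{\tau_{\downarrow b}=\infty\}$ equal to $0$), and for $s>0$ set $$\widetilde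 Z_b(s)=\int_b^\infty e^{-sx}Z^{\downarrow}(x,b)\,dx .$$ $E_i$ is the $m\times m$ matrix whose only nonzero entry is a $1$ in position $(i,i)$, and $A(s)=\mathrm{diag}\big(\gamma_i/(z_i-s)\big)_{i\in E}$. For finite words $\alpha=(i_1,\dots,i_n)$ in $E$ put $|\alpha|=n$, $p_\alpha=\prod_{\ell=1}^np_{i_\ell}$ ($p_\varnothing=1$), $\alpha\upharpoonright_k=(i_1,\dots,i_k)$; $\mathcal P=\{z_jp_\alpha:j\in E,\ \alpha\text{ a finite word, possibly empty}\}$; for $n\ge1$ $$K_\alpha(s)=A(s)E_{i_1}Q\prod_{k=2}^{n}A\big(s/p_{\alpha\upharpoonright_{k-1}}\big)E_{i_k}Q$$ (ordered from left to right in increasing $k$; empty product $=I$), and for a matrix-valued function $G$ $$(\mathcal R G)(s)=G(s)+\sum_{n\ge1}\sum_{|\alpha|=n}K_\alpha(s)\,G(s/p_\alpha).$$ Let $R_b(s)$ be the diagonal matrix with $i$-th diagonal entry $$\int_{p_ib}^{b}\Big[e^{-sy/p_i}-e^{\,b(z_i-s)-(z_i/p_i)y}\Big]dy=\frac{p_i}{s}\big(e^{-sb}-e^{-sb/p_i}\big)-\frac{p_i}{z_i}e^{b(z_i-s)}\big(e^{-bz_i}-e^{-bz_i/p_i}\big).$$ For an $m\times m$ matrix $H$ put $F_b^{H}(s)=R_b(s)Q+e^{-bs}H$ and $\widetilde Z_b^{H}(s)=(\mathcal R(AF_b^{H}))(s)$, which solves the recursion $\widetilde Z_b^{H}(s)=A(s)F_b^{H}(s)+A(s)\sum_{i}E_iQ\widetilde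 Z_b^{H}(s/p_i)$. Define $$H_b=-\sum_{i=1}^m e^{z_ib}E_iQ\,\widetilde Z_b(z_i/p_i),$$ and, if $z_i/p_i\notin\mathcal P$ for every $i\in E$, the affine map $$\mathcal C_b(H)=-\sum_{i=1}^m e^{z_ib}E_iQ\,\widetilde Z_b^{H}(z_i/p_i).$$ *)

theory Defs
  imports "HOL-Probability.Probability"
begin

text \<open>
  The phase space is a finite type \<open>'m\<close>; \<open>m \<times> m\<close> matrices are elements of \<open>real ^ 'm ^ 'm\<close>
  (row index first, i.e. \<open>Q $ i $ j\<close> is the entry \<open>q\<^sub>i\<^sub>j\<close>).
\<close>

definition stochastic_matrix :: "real ^ 'm ^ 'm \<Rightarrow> bool" where
  "stochastic_matrix Q \<longleftrightarrow>
     (\<forall>i j. 0 \<le> Q $ i $ j) \<and> (\<forall>i. (\<Sum>j\<in>UNIV. Q $ i $ j) = 1)"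


section \<open>The process\<close>

text \<open>
  The process is constructed pathwise from i.i.d. innovations \<open>(e, f)\<close>: \<open>e\<close> is standard
  exponential and, independently, \<open>f\<close> is a random map on the phases whose values \<open>f i\<close> are
  independent with law \<open>q\<^sub>i\<^sub>\<cdot>\<close>. If the current phase is \<open>i\<close>, the holding time is \<open>e / \<lambda>\<^sub>i\<close>
  (exponential with rate \<open>\<lambda>\<^sub>i\<close>) and the phase after the jump is \<open>f i\<close>.
\<close>

definition phase_step :: "real ^ 'm ^ 'm \<Rightarrow> 'm \<Rightarrow> 'm pmf" where
  "phase_step Q i = embed_pmf (\<lambda>j. Q $ i $ j)"

lemma pmf_phase_step:
  fixes Q :: "real ^ 'm ^ 'm"
  assumes "stochastic_matrix Q"
  shows "pmf (phase_step Q i) j = Q $ i $ j"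
  unfolding phase_step_def
proof (rule pmf_embed_pmf)
  show "\<And>x. 0 \<le> Q $ i $ x"
    using assms by (simp add: stochastic_matrix_def)
  then show "(\<integral>\<^sup>+ x. ennreal (Q $ i $ x) \<partial>count_space UNIV) = 1"
    using assms by (simp add: stochastic_matrix_def nn_integral_count_space_finite sum_ennreal)
qed

definition innovation :: "real ^ 'm ^ 'm \<Rightarrow> (real \<times> ('m \<Rightarrow> 'm)) measure" where
  "innovation Q =
     density lborel (exponential_density 1)
       \<Otimes>\<^sub>M measure_pmf (Pi_pmf UNIV undefined (phase_step Q))"

text \<open>
  The completion makes null sets (non-positive innovations, explosion) irrelevant for
  measurability.
\<close>

definition path_space :: "real ^ 'm ^ 'm \<Rightarrow> (real \<times> ('m \<Rightarrow> 'm)) stream measure" where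
  "path_space Q = completion (stream_space (innovation Q))"

text \<open>Phase after the \<open>n\<close>-th jump, for initial phase \<open>i\<close>.\<close>

primrec phase :: "'m \<Rightarrow> (real \<times> ('m \<Rightarrow> 'm)) stream \<Rightarrow> nat \<Rightarrow> 'm" where
  "phase i \<omega> 0 = i"
| "phase i \<omega> (Suc n) = snd (\<omega> !! n) (phase i \<omega> n)"

definition holding_time ::
  "('m \<Rightarrow> real) \<Rightarrow> 'm \<Rightarrow> (real \<times> ('m \<Rightarrow> 'm)) stream \<Rightarrow> nat \<Rightarrow> real" where
  "holding_time lam i \<omega> n = fst (\<omega> !! n) / lam (phase i \<omega> n)"

definition jump_time ::
  "('m \<Rightarrow> real) \<Rightarrow> 'm \<Rightarrow> (real \<times> ('m \<Rightarrow> 'm)) stream \<Rightarrow> nat \<Rightarrow> real" where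
  "jump_time lam i \<omega> n = (\<Sum>k<n. holding_time lam i \<omega> k)"

text \<open>Level immediately after the \<open>n\<close>-th jump, for initial state \<open>(x, i)\<close>.\<close>

primrec jump_level ::
  "('m \<Rightarrow> real) \<Rightarrow> ('m \<Rightarrow> real) \<Rightarrow> ('m \<Rightarrow> real) \<Rightarrow> real \<Rightarrow> 'm
     \<Rightarrow> (real \<times> ('m \<Rightarrow> 'm)) stream \<Rightarrow> nat \<Rightarrow> real" where
  "jump_level c lam p x i \<omega> 0 = x"
| "jump_level c lam p x i \<omega> (Suc n) =
     p (phase i \<omega> n)
       * (jump_level c lam p x i \<omega> n + holding_time lam i \<omega> n / c (phase i \<omega> n))"

text \<open>Number of jumps in \<open>[0, t]\<close>.\<close>

definition jump_count ::
  "('m \<Rightarrow> real) \<Rightarrow> 'm \<Rightarrow> (real \<times> ('m \<Rightarrow> 'm)) stream \<Rightarrow> real \<Rightarrow> nat" where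
  "jump_count lam i \<omega> t = (LEAST n. t < jump_time lam i \<omega> (Suc n))"

definition J_process ::
  "('m \<Rightarrow> real) \<Rightarrow> 'm \<Rightarrow> (real \<times> ('m \<Rightarrow> 'm)) stream \<Rightarrow> real \<Rightarrow> 'm" where
  "J_process lam i \<omega> t = phase i \<omega> (jump_count lam i \<omega> t)"

definition X_process ::
  "('m \<Rightarrow> real) \<Rightarrow> ('m \<Rightarrow> real) \<Rightarrow> ('m \<Rightarrow> real) \<Rightarrow> real \<Rightarrow> 'm
     \<Rightarrow> (real \<times> ('m \<Rightarrow> 'm)) stream \<Rightarrow> real \<Rightarrow> real" where
  "X_process c lam p x i \<omega> t =
     (let n = jump_count lam i \<omega> t
      in jump_level c lam p x i \<omega> n + (t - jump_time lam i \<omega> n) / c (phase i \<omega> n))"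


section \<open>First passage below a level\<close>

text \<open>Times at which the level is at most \<open>b\<close>; the first passage time is infinite iff this is empty.\<close>

definition passage_times ::
  "('m \<Rightarrow> real) \<Rightarrow> ('m \<Rightarrow> real) \<Rightarrow> ('m \<Rightarrow> real) \<Rightarrow> real \<Rightarrow> real \<Rightarrow> 'm
     \<Rightarrow> (real \<times> ('m \<Rightarrow> 'm)) stream \<Rightarrow> real set" where
  "passage_times c lam p b x i \<omega> = {t. 0 \<le> t \<and> X_process c lam p x i \<omega> t \<le> b}"

definition Z_down ::
  "('m::finite \<Rightarrow> real) \<Rightarrow> ('m \<Rightarrow> real) \<Rightarrow> ('m \<Rightarrow> real) \<Rightarrow> real ^ 'm ^ 'm \<Rightarrow> real
     \<Rightarrow> real \<Rightarrow> real \<Rightarrow> real ^ 'm ^ 'm" where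
  "Z_down c lam p Q w x b =
     (\<chi> i j. LINT \<omega>|path_space Q.
        (let T = passage_times c lam p b x i \<omega>; \<tau> = Inf T
         in if T \<noteq> {} \<and> J_process lam i \<omega> \<tau> = j then exp (- w * \<tau>) else 0))"

definition Z_tilde ::
  "('m::finite \<Rightarrow> real) \<Rightarrow> ('m \<Rightarrow> real) \<Rightarrow> ('m \<Rightarrow> real) \<Rightarrow> real ^ 'm ^ 'm \<Rightarrow> real
     \<Rightarrow> real \<Rightarrow> real \<Rightarrow> real ^ 'm ^ 'm" where
  "Z_tilde c lam p Q w b s = (LINT x:{b..}|lborel. exp (- s * x) *\<^sub>R Z_down c lam p Q w x b)"


section \<open>The resolvent series\<close>

definition zpar :: "('m \<Rightarrow> real) \<Rightarrow> ('m \<Rightarrow> real) \<Rightarrow> real \<Rightarrow> 'm \<Rightarrow> real" where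
  "zpar c lam w i = c i * (lam i + w)"

definition gpar :: "('m \<Rightarrow> real) \<Rightarrow> ('m \<Rightarrow> real) \<Rightarrow> ('m \<Rightarrow> real) \<Rightarrow> 'm \<Rightarrow> real" where
  "gpar c lam p i = c i * lam i / p i"

definition diag_mat :: "('m \<Rightarrow> real) \<Rightarrow> real ^ 'm ^ 'm" where
  "diag_mat d = (\<chi> i j. if i = j then d i else 0)"

definition E_mat :: "'m \<Rightarrow> real ^ 'm ^ 'm" where
  "E_mat i = (\<chi> k l. if k = i \<and> l = i then 1 else 0)"

definition A_mat ::
  "('m \<Rightarrow> real) \<Rightarrow> ('m \<Rightarrow> real) \<Rightarrow> ('m \<Rightarrow> real) \<Rightarrow> real \<Rightarrow> real \<Rightarrow> real ^ 'm ^ 'm" where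
  "A_mat c lam p w s = diag_mat (\<lambda>i. gpar c lam p i / (zpar c lam w i - s))"

definition word_weight :: "('m \<Rightarrow> real) \<Rightarrow> 'm list \<Rightarrow> real" where
  "word_weight p \<alpha> = prod_list (map p \<alpha>)"

definition pole_set :: "('m \<Rightarrow> real) \<Rightarrow> ('m \<Rightarrow> real) \<Rightarrow> ('m \<Rightarrow> real) \<Rightarrow> real \<Rightarrow> real set" where
  "pole_set c lam p w = {zpar c lam w j * word_weight p \<alpha> | j \<alpha>. True}"

text \<open>
  With list positions counted from \<open>0\<close>, the factor at position \<open>k\<close> is evaluated at
  \<open>s / word_weight p (take k \<alpha>)\<close>; for \<open>k = 0\<close> this is \<open>s\<close> itself. The product is ordered
  from left to right.
\<close>

definition K_mat ::
  "('m::finite \<Rightarrow> real) \<Rightarrow> ('m \<Rightarrow> real) \<Rightarrow> ('m \<Rightarrow> real) \<Rightarrow> real ^ 'm ^ 'm \<Rightarrow> real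
     \<Rightarrow> 'm list \<Rightarrow> real \<Rightarrow> real ^ 'm ^ 'm" where
  "K_mat c lam p Q w \<alpha> s =
     foldr (**)
       (map (\<lambda>k. A_mat c lam p w (s / word_weight p (take k \<alpha>)) ** E_mat (\<alpha> ! k) ** Q)
         [0..<length \<alpha>])
       (mat 1)"

definition R_term ::
  "('m::finite \<Rightarrow> real) \<Rightarrow> ('m \<Rightarrow> real) \<Rightarrow> ('m \<Rightarrow> real) \<Rightarrow> real ^ 'm ^ 'm \<Rightarrow> real
     \<Rightarrow> (real \<Rightarrow> real ^ 'm ^ 'm) \<Rightarrow> real \<Rightarrow> 'm list \<Rightarrow> real ^ 'm ^ 'm" where
  "R_term c lam p Q w G s \<alpha> = K_mat c lam p Q w \<alpha> s ** G (s / word_weight p \<alpha>)"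

definition R_op ::
  "('m::finite \<Rightarrow> real) \<Rightarrow> ('m \<Rightarrow> real) \<Rightarrow> ('m \<Rightarrow> real) \<Rightarrow> real ^ 'm ^ 'm \<Rightarrow> real
     \<Rightarrow> (real \<Rightarrow> real ^ 'm ^ 'm) \<Rightarrow> real \<Rightarrow> real ^ 'm ^ 'm" where
  "R_op c lam p Q w G s =
     G s + (\<Sum>n. \<Sum>\<alpha> | length \<alpha> = Suc n. R_term c lam p Q w G s \<alpha>)"

definition Rb_mat ::
  "('m::finite \<Rightarrow> real) \<Rightarrow> ('m \<Rightarrow> real) \<Rightarrow> ('m \<Rightarrow> real) \<Rightarrow> real \<Rightarrow> real \<Rightarrow> real \<Rightarrow> real ^ 'm ^ 'm" where
  "Rb_mat c lam p w b s =
     diag_mat (\<lambda>i. LINT y:{p i * b..b}|lborel.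
       exp (- s * y / p i)
         - exp (b * (zpar c lam w i - s) - zpar c lam w i / p i * y))"

definition F_mat ::
  "('m::finite \<Rightarrow> real) \<Rightarrow> ('m \<Rightarrow> real) \<Rightarrow> ('m \<Rightarrow> real) \<Rightarrow> real ^ 'm ^ 'm \<Rightarrow> real
     \<Rightarrow> real \<Rightarrow> real ^ 'm ^ 'm \<Rightarrow> real \<Rightarrow> real ^ 'm ^ 'm" where
  "F_mat c lam p Q w b H s = Rb_mat c lam p w b s ** Q + exp (- b * s) *\<^sub>R H"

definition AF_mat ::
  "('m::finite \<Rightarrow> real) \<Rightarrow> ('m \<Rightarrow> real) \<Rightarrow> ('m \<Rightarrow> real) \<Rightarrow> real ^ 'm ^ 'm \<Rightarrow> real
     \<Rightarrow> real \<Rightarrow> real ^ 'm ^ 'm \<Rightarrow> real \<Rightarrow> real ^ 'm ^ 'm" where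
  "AF_mat c lam p Q w b H s = A_mat c lam p w s ** F_mat c lam p Q w b H s"

definition Z_tilde_H ::
  "('m::finite \<Rightarrow> real) \<Rightarrow> ('m \<Rightarrow> real) \<Rightarrow> ('m \<Rightarrow> real) \<Rightarrow> real ^ 'm ^ 'm \<Rightarrow> real
     \<Rightarrow> real \<Rightarrow> real ^ 'm ^ 'm \<Rightarrow> real \<Rightarrow> real ^ 'm ^ 'm" where
  "Z_tilde_H c lam p Q w b H s = R_op c lam p Q w (AF_mat c lam p Q w b H) s"

definition H_mat ::
  "('m::finite \<Rightarrow> real) \<Rightarrow> ('m \<Rightarrow> real) \<Rightarrow> ('m \<Rightarrow> real) \<Rightarrow> real ^ 'm ^ 'm \<Rightarrow> real
     \<Rightarrow> real \<Rightarrow> real ^ 'm ^ 'm" where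
  "H_mat c lam p Q w b =
     - (\<Sum>i\<in>UNIV. exp (zpar c lam w i * b) *\<^sub>R
          (E_mat i ** Q ** Z_tilde c lam p Q w b (zpar c lam w i / p i)))"

text \<open>Only meaningful if no \<open>zpar c lam w i / p i\<close> lies in \<open>pole_set c lam p w\<close>.\<close>

definition C_map ::
  "('m::finite \<Rightarrow> real) \<Rightarrow> ('m \<Rightarrow> real) \<Rightarrow> ('m \<Rightarrow> real) \<Rightarrow> real ^ 'm ^ 'm \<Rightarrow> real
     \<Rightarrow> real \<Rightarrow> real ^ 'm ^ 'm \<Rightarrow> real ^ 'm ^ 'm" where
  "C_map c lam p Q w b H =
     - (\<Sum>i\<in>UNIV. exp (zpar c lam w i * b) *\<^sub>R
          (E_mat i ** Q ** Z_tilde_H c lam p Q w b H (zpar c lam w i / p i)))"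

end

theory Submission
  imports Defs
begin

text \<open>
  Almost surely the level first drops to \<open>b\<close> at a jump time. Conditioning on the first jump gives,
  with \<open>U\<^sub>i\<^sub>j(x)\<close> the \<open>(i, j)\<close> entry of \<open>Z\<^sup>\<down>(x, b)\<close>, the renewal equation
  \<open>U\<^sub>i\<^sub>j(x) = \<integral> \<gamma>\<^sub>i exp (- z\<^sub>i (y / p\<^sub>i - x)) (Q U)\<^sub>i\<^sub>j(y) dy\<close> over \<open>y \<ge> p\<^sub>i x\<close>, for \<open>x > b\<close>. Taking Laplace
  transforms and exchanging the two (nonnegative) integrals turns it into the recursion
  \<open>Z(s) = A(s) (F(s) + \<Sum>\<^sub>i E\<^sub>i Q Z(s / p\<^sub>i))\<close>, where the boundary terms at \<open>x = b\<close> are what \<open>H\<^sub>b\<close>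
  collects. Iterating the recursion along words gives the resolvent series; the remainder vanishes
  because \<open>A\<close> tends to \<open>0\<close> at infinity. The poles are removable simply because the
  left-hand side is continuous on \<open>(0, \<infinity>)\<close>.
\<close>

section \<open>The resolvent series\<close>

lemma bounded_bilinear_matrix_mult:
  "bounded_bilinear ((**) :: real ^ 'b::finite ^ 'a::finite \<Rightarrow> real ^ 'c::finite ^ 'b \<Rightarrow> real ^ 'c ^ 'a)"
  unfolding bilinear_conv_bounded_bilinear[symmetric] bilinear_def
  by (auto intro!: linearI simp: vec_eq_iff matrix_matrix_mult_def sum.distrib algebra_simps sum_distrib_left)

text \<open>The norm on \<open>real ^ 'm ^ 'm\<close> comes from the nested Euclidean structure;
  bilinearity supplies a constant \<open>C\<close> with norm (X Y) \<le> norm X * norm Y * C, as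
  well as distributivity over finite sums.\<close>

interpretation matrix_mult: bounded_bilinear
  "(**) :: real ^ 'b::finite ^ 'a::finite \<Rightarrow> real ^ 'c::finite ^ 'b \<Rightarrow> real ^ 'c ^ 'a"
  by (rule bounded_bilinear_matrix_mult)

lemma foldr_matrix_mult:
  "foldr (**) Ms N = foldr (**) Ms (mat 1) ** (N :: real ^ 'm::finite ^ 'm)"
  by (induction Ms) (simp_all add: matrix_mul_assoc)

lemma word_weight_snoc: "word_weight p (\<alpha> @ [i]) = word_weight p \<alpha> * p i"
  by (simp add: word_weight_def)

lemma word_weight_Nil: "word_weight p [] = 1"
  by (simp add: word_weight_def)

lemma K_mat_Nil: "K_mat c lam p Q w [] s = mat 1"
  by (simp add: K_mat_def)

text \<open>Words grow at the right end: a letter appended to \<alpha> brings a factor evaluated at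
  \<open>s / word_weight p \<alpha>\<close> and leaves all earlier factors unchanged. This matches
  inserting the recursion at the innermost argument.\<close>

lemma K_mat_snoc:
  "K_mat c lam p Q w (\<alpha> @ [i]) s =
     K_mat c lam p Q w \<alpha> s ** (A_mat c lam p w (s / word_weight p \<alpha>) ** E_mat i ** Q)"
proof -
  let ?M = "\<lambda>\<alpha> k. A_mat c lam p w (s / word_weight p (take k \<alpha>)) ** E_mat (\<alpha> ! k) ** Q"
  have "map (?M (\<alpha> @ [i])) [0..<length (\<alpha> @ [i])] = map (?M \<alpha>) [0..<length \<alpha>]
      @ [A_mat c lam p w (s / word_weight p \<alpha>) ** E_mat i ** Q]"
    by (auto simp: nth_append)
  then show ?thesis
    unfolding K_mat_def
    by (simp only: foldr_append) (subst foldr_matrix_mult, simp)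
qed

lemma finite_words: "finite {\<alpha> :: 'm::finite list. length \<alpha> = n}"
  using finite_lists_length_eq[of "UNIV :: 'm set" n] by simp

lemma card_words: "card {\<alpha> :: 'm::finite list. length \<alpha> = n} = CARD('m) ^ n"
  using card_lists_length_eq[of "UNIV :: 'm set" n] by simp

lemma sum_words_Suc:
  fixes f :: "'m::finite list \<Rightarrow> 'a::comm_monoid_add"
  shows "(\<Sum>\<alpha> | length \<alpha> = Suc n. f \<alpha>) = (\<Sum>\<alpha> | length \<alpha> = n. \<Sum>i\<in>UNIV. f (\<alpha> @ [i]))"
proof -
  have "{\<alpha> :: 'm list. length \<alpha> = Suc n} = (\<lambda>(\<alpha>, i). \<alpha> @ [i]) ` ({\<alpha>. length \<alpha> = n} \<times> UNIV)"
  proof (intro equalityI subsetI)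
    fix \<alpha> :: "'m list" assume "\<alpha> \<in> {\<alpha>. length \<alpha> = Suc n}"
    then show "\<alpha> \<in> (\<lambda>(\<alpha>, i). \<alpha> @ [i]) ` ({\<alpha>. length \<alpha> = n} \<times> UNIV)"
      by (cases \<alpha> rule: rev_cases) (auto intro!: image_eqI)
  qed auto
  moreover have "inj_on (\<lambda>(\<alpha>, i). \<alpha> @ [i]) ({\<alpha> :: 'm list. length \<alpha> = n} \<times> UNIV)"
    by (auto simp: inj_on_def)
  ultimately have "(\<Sum>\<alpha> | length \<alpha> = Suc n. f \<alpha>)
      = (\<Sum>(\<alpha>, i)\<in>{\<alpha>. length \<alpha> = n} \<times> UNIV. f (\<alpha> @ [i]))"
    by (simp add: sum.reindex case_prod_beta')
  then show ?thesis by (simp add: sum.cartesian_product)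
qed

section \<open>Convergence estimates for series over words\<close>

lemma summable_prod_vanishing:
  fixes q :: "nat \<Rightarrow> real"
  assumes "q \<longlonglongrightarrow> 0"
  shows "summable (\<lambda>n. \<Prod>k<n. q k)"
proof -
  obtain N where N: "\<And>n. n \<ge> N \<Longrightarrow> \<bar>q n\<bar> < 1/2"
    using LIMSEQ_D[OF assms, of "1/2"] by auto
  show ?thesis
  proof (rule summable_ratio_test)
    show "norm (\<Prod>k<Suc n. q k) \<le> 1/2 * norm (\<Prod>k<n. q k)" if "N \<le> n" for n
      using mult_right_mono[OF less_imp_le[OF N[OF that]], of "\<bar>\<Prod>k<n. q k\<bar>"]
      by (simp add: abs_mult mult.commute)
  qed simp
qed

text \<open>A finite set of words has bounded length, so its sum is at most a partial sum of
  \<open>g\<close>. This turns bounds level by level into unconditional summability over all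
  words.\<close>

lemma summable_on_lists:
  fixes f :: "'m::finite list \<Rightarrow> real"
  assumes nonneg: "\<And>\<alpha>. 0 \<le> f \<alpha>" and g: "summable g"
    and le: "\<And>n. (\<Sum>\<alpha> | length \<alpha> = n. f \<alpha>) \<le> g n"
  shows "f summable_on X"
proof -
  have "f summable_on UNIV"
  proof (rule nonneg_bdd_above_summable_on)
    have "sum f F \<le> suminf g" if F: "finite F" for F
    proof -
      obtain N where "length ` F \<subseteq> {..<N}"
        using F finite_nat_bounded[of "length ` F"] by auto
      then have "F \<subseteq> (\<Union>n<N. {\<alpha>. length \<alpha> = n})" by auto
      then have "sum f F \<le> sum f (\<Union>n<N. {\<alpha>. length \<alpha> = n})"
        by (intro sum_mono2) (auto simp: nonneg finite_words)
      also have "\<dots> = (\<Sum>n<N. \<Sum>\<alpha> | length \<alpha> = n. f \<alpha>)"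
        by (intro sum.UNION_disjoint) (auto simp: finite_words)
      also have "\<dots> \<le> sum g {..<N}"
        by (intro sum_mono le)
      also have "\<dots> \<le> suminf g"
        by (intro sum_le_suminf g)
          (auto intro: order_trans[OF sum_nonneg le] simp: nonneg)
      finally show ?thesis .
    qed
    then show "bdd_above (sum f ` {F. F \<subseteq> UNIV \<and> finite F})"
      by (auto simp: bdd_above_def)
  qed (rule nonneg)
  then show ?thesis by (rule summable_on_subset_banach) simp
qed

lemma A_mat_tendsto_0: "(A_mat c lam p w \<longlongrightarrow> 0) at_top"
proof (intro vec_tendstoI)
  fix i j
  have "filterlim (\<lambda>r. - zpar c lam w i + r) at_top at_top"
    by (rule filterlim_tendsto_add_at_top[OF tendsto_const filterlim_ident])
  then have "((\<lambda>r. - (gpar c lam p i / (- zpar c lam w i + r))) \<longlongrightarrow> - 0) at_top"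
    by (intro tendsto_minus tendsto_divide_0[OF tendsto_const] filterlim_at_top_imp_at_infinity)
  moreover have "- (gpar c lam p i / (- zpar c lam w i + r)) = gpar c lam p i / (zpar c lam w i - r)" for r
    by (simp add: minus_divide_right)
  ultimately have "((\<lambda>r. gpar c lam p i / (zpar c lam w i - r)) \<longlongrightarrow> 0) at_top"
    by simp
  then show "((\<lambda>r. A_mat c lam p w r $ i $ j) \<longlongrightarrow> 0 $ i $ j) at_top"
    by (cases "i = j") (simp_all add: A_mat_def diag_mat_def)
qed

text \<open>Along a word of length \<open>n\<close> the argument of \<open>A\<close> grows at least geometrically while
  \<open>A\<close> vanishes at infinity, so the product of \<open>n\<close> factors beats the \<open>m ^ n\<close> many words.\<close>

lemma K_mat_bound:
  fixes c lam p :: "'m::finite \<Rightarrow> real" and Q :: "real ^ 'm ^ 'm"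
  assumes p: "\<And>i. 0 < p i" "\<And>i. p i < 1" and s: "s > 0"
  obtains a :: real and g :: "nat \<Rightarrow> real" where
    "\<And>\<alpha>. norm (A_mat c lam p w (s / word_weight p \<alpha>)) \<le> a"
    "summable g" "\<And>n. 0 \<le> g n"
    "\<And>n. (\<Sum>\<alpha> | length \<alpha> = n. norm (K_mat c lam p Q w \<alpha> s)) \<le> g n"
proof -
  let ?W = "\<lambda>n. {\<alpha> :: 'm list. length \<alpha> = n}"
  let ?A = "A_mat c lam p w"
  obtain C :: real where C: "0 \<le> C" "\<And>X Y. norm ((X :: real ^ 'm ^ 'm) ** (Y :: real ^ 'm ^ 'm)) \<le> norm X * norm Y * C"
    using matrix_mult.nonneg_bounded by blast
  \<comment> \<open>There are finitely many words of each length, so the maximum exists and the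
    bound on \<open>A\<close> depends on the length alone.\<close>
  define a where "a n = Max ((\<lambda>\<alpha>. norm (?A (s / word_weight p \<alpha>))) ` ?W n)" for n
  have W_ne: "?W n \<noteq> {}" for n
    using Ex_list_of_length[of n] by auto
  have a: "norm (?A (s / word_weight p \<alpha>)) \<le> a (length \<alpha>)" for \<alpha>
    unfolding a_def by (intro Max_ge finite_imageI finite_words) auto
  have a_nonneg: "0 \<le> a n" for n
    using W_ne[of n] a by (metis (mono_tags) Collect_empty_eq norm_ge_zero order_trans)
  define pm where "pm = Max (range p)"
  have pm: "0 < pm" "pm < 1" "p i \<le> pm" for i
    unfolding pm_def using p by (auto simp: Max_gr_iff)
  have weight: "0 < word_weight p \<alpha> \<and> word_weight p \<alpha> \<le> pm ^ length \<alpha>" for \<alpha>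
  proof (induction \<alpha>)
    case (Cons i \<alpha>)
    then show ?case
      by (auto simp: word_weight_def p pm intro!: mult_mono less_imp_le[OF p(1)] less_imp_le[OF pm(1)])
  qed (simp add: word_weight_def)
  have a_lim: "a \<longlonglongrightarrow> 0"
  proof (rule LIMSEQ_I)
    fix e :: real assume e: "0 < e"
    have "\<forall>\<^sub>F r in at_top. norm (?A r) < e"
      using tendstoD[OF A_mat_tendsto_0 e] by simp
    then obtain R where R: "\<And>r. R \<le> r \<Longrightarrow> norm (?A r) < e"
      by (auto simp: eventually_at_top_linorder)
    have "(\<lambda>n. pm ^ n * (\<bar>R\<bar> + 1)) \<longlonglongrightarrow> 0 * (\<bar>R\<bar> + 1)"
      using pm by (intro tendsto_intros LIMSEQ_power_zero) auto
    then have "\<forall>\<^sub>F n in sequentially. pm ^ n * (\<bar>R\<bar> + 1) < s"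
      using s by (intro order_tendstoD(2)[where y=0]) auto
    then obtain N where N: "\<And>n. N \<le> n \<Longrightarrow> pm ^ n * (\<bar>R\<bar> + 1) < s"
      by (auto simp: eventually_sequentially)
    show "\<exists>no. \<forall>n\<ge>no. norm (a n - 0) < e"
    proof (intro exI[of _ N] allI impI)
      fix n assume n: "N \<le> n"
      have "norm (?A (s / word_weight p \<alpha>)) < e" if "length \<alpha> = n" for \<alpha>
      proof (rule R)
        \<comment> \<open>The threshold \<open>\<bar>R\<bar> + 1\<close> replaces \<open>R\<close>
          to make the factor positive whatever the sign of \<open>R\<close>.\<close>
        have "(\<bar>R\<bar> + 1) * word_weight p \<alpha> \<le> (\<bar>R\<bar> + 1) * pm ^ n"
          using weight[of \<alpha>] that by (intro mult_left_mono) auto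
        also have "\<dots> \<le> s"
          using N[OF n] by (simp add: mult.commute)
        finally have "\<bar>R\<bar> + 1 \<le> s / word_weight p \<alpha>"
          using weight[of \<alpha>] by (simp add: pos_le_divide_eq)
        then show "R \<le> s / word_weight p \<alpha>" by linarith
      qed
      then have "a n < e"
        unfolding a_def using W_ne[of n] by (subst Max_less_iff) (auto simp: finite_words)
      then show "norm (a n - 0) < e"
        using a_nonneg[of n] by simp
    qed
  qed
  \<comment> \<open>One factor \<open>C\<close> for each of the three products made when a letter is
    appended; the sum over all \<open>E_mat i\<close> dominates the norm for any single
    letter.\<close>
  define D where "D = C * C * C * (\<Sum>i\<in>UNIV. norm (E_mat i :: real ^ 'm ^ 'm)) * norm Q"
  have D_nonneg: "0 \<le> D"
    unfolding D_def by (intro mult_nonneg_nonneg C sum_nonneg) auto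
  let ?K = "\<lambda>\<alpha>. K_mat c lam p Q w \<alpha> s"
  have K: "norm (?K \<alpha>) \<le> norm (mat 1 :: real ^ 'm ^ 'm) * (\<Prod>k<length \<alpha>. D * a k)" for \<alpha>
  proof (induction \<alpha> rule: rev_induct)
    case (snoc i \<alpha>)
    let ?r = "s / word_weight p \<alpha>"
    have E: "norm (E_mat i :: real ^ 'm ^ 'm) \<le> (\<Sum>i\<in>UNIV. norm (E_mat i :: real ^ 'm ^ 'm))"
      by (rule member_le_sum) auto
    have "norm (?A ?r ** E_mat i ** Q) \<le> norm (?A ?r ** E_mat i) * norm Q * C"
      by (rule C)
    also have "\<dots> \<le> (norm (?A ?r) * norm (E_mat i :: real ^ 'm ^ 'm) * C) * norm Q * C"
      by (intro mult_right_mono C norm_ge_zero)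
    also have "\<dots> \<le> (a (length \<alpha>) * (\<Sum>i\<in>UNIV. norm (E_mat i :: real ^ 'm ^ 'm)) * C) * norm Q * C"
      by (intro mult_right_mono mult_mono C E a a_nonneg norm_ge_zero)
    finally have B: "norm (?A ?r ** E_mat i ** Q) * C \<le> D * a (length \<alpha>)"
      using C(1) unfolding D_def
      by (auto dest: mult_right_mono[OF _ C(1)] simp: mult_ac)
    have "norm (?K (\<alpha> @ [i])) \<le> norm (?K \<alpha>) * norm (?A ?r ** E_mat i ** Q) * C"
      unfolding K_mat_snoc by (rule C)
    also have "\<dots> \<le> norm (?K \<alpha>) * (D * a (length \<alpha>))"
      using B by (simp add: mult.assoc mult_left_mono)
    also have "\<dots> \<le> norm (mat 1 :: real ^ 'm ^ 'm) * (\<Prod>k<length \<alpha>. D * a k) * (D * a (length \<alpha>))"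
      by (intro mult_right_mono snoc mult_nonneg_nonneg D_nonneg a_nonneg)
    finally show ?case by (simp add: mult_ac)
  qed (simp add: K_mat_Nil)
  \<comment> \<open>The number \<open>CARD('m) ^ n\<close> of words is spread over the product, one
    factor per letter. The factors still tend to 0.\<close>
  let ?g = "\<lambda>n. norm (mat 1 :: real ^ 'm ^ 'm) * (\<Prod>k<n. real CARD('m) * D * a k)"
  have "Bseq a"
    by (rule convergent_imp_Bseq[OF convergentI[OF a_lim]])
  then obtain B where B: "\<And>n. norm (a n) \<le> B"
    unfolding Bseq_def by blast
  show thesis
  proof (rule that)
    show "norm (?A (s / word_weight p \<alpha>)) \<le> B" for \<alpha>
      using a[of \<alpha>] B[of "length \<alpha>"] by (simp add: abs_le_iff)
    have "(\<lambda>k. real CARD('m) * D * a k) \<longlonglongrightarrow> real CARD('m) * D * 0"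
      by (intro tendsto_intros a_lim)
    then show "summable ?g"
      by (intro summable_mult summable_prod_vanishing) simp
    show "0 \<le> ?g n" for n
      by (intro mult_nonneg_nonneg prod_nonneg) (auto simp: D_nonneg a_nonneg)
    have "(\<Sum>\<alpha>\<in>?W n. norm (?K \<alpha>)) \<le> (\<Sum>\<alpha>\<in>?W n. norm (mat 1 :: real ^ 'm ^ 'm) * (\<Prod>k<n. D * a k))" for n
      using K by (intro sum_mono) auto
    then show "(\<Sum>\<alpha>\<in>?W n. norm (?K \<alpha>)) \<le> ?g n" for n
      by (simp add: card_words prod.distrib mult_ac)
  qed
qed

text \<open>Inserting the recursion into itself n times gives the partial sum for \<open>G\<close>
  over words shorter than n plus a remainder over words of length n, which is at most a constant
  times \<open>g n\<close>. The hypotheses concern only the points s / p_\<alpha>, because the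
  recursion for \<open>Z_tilde\<close> is available only away from the points z_i.\<close>

lemma resolvent_iteration:
  fixes c lam p :: "'m::finite \<Rightarrow> real" and Q :: "real ^ 'm ^ 'm"
  assumes p: "\<And>i. 0 < p i" "\<And>i. p i < 1" and s: "s > 0"
    and rec: "\<And>\<alpha> r. r = s / word_weight p \<alpha> \<Longrightarrow>
      Z r = G r + (\<Sum>i\<in>UNIV. A_mat c lam p w r ** E_mat i ** Q ** Z (r / p i))"
    and bound: "\<And>\<alpha>. norm (Z (s / word_weight p \<alpha>)) \<le> B"
  shows "(\<lambda>\<alpha>. norm (R_term c lam p Q w G s \<alpha>)) summable_on X"
    and "Z s = R_op c lam p Q w G s"
proof -
  let ?A = "A_mat c lam p w" and ?K = "\<lambda>\<alpha>. K_mat c lam p Q w \<alpha> s"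
  let ?r = "\<lambda>\<alpha>. s / word_weight p \<alpha>"
  obtain a g where a: "\<And>\<alpha>. norm (?A (?r \<alpha>)) \<le> a"
    and g: "summable g" "\<And>n. 0 \<le> g n" "\<And>n. (\<Sum>\<alpha> | length \<alpha> = n. norm (?K \<alpha>)) \<le> g n"
    by (rule K_mat_bound[where c=c and lam=lam and Q=Q and w=w, OF p s]) (rule that)
  obtain C :: real where C: "0 \<le> C" "\<And>X Y. norm ((X :: real ^ 'm ^ 'm) ** (Y :: real ^ 'm ^ 'm)) \<le> norm X * norm Y * C"
    using matrix_mult.nonneg_bounded by blast
  have B: "0 \<le> B" using bound[of "[]"] norm_ge_zero order_trans by blast
  have a0: "0 \<le> a" using a[of "[]"] norm_ge_zero order_trans by blast
  have term_bound: "(\<Sum>\<alpha> | length \<alpha> = n. norm (R_term c lam p Q w F s \<alpha>)) \<le> D * C * g n"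
    if F: "\<And>\<alpha>. norm (F (?r \<alpha>)) \<le> D" for F D n
  proof -
    have D: "0 \<le> D" using F[of "[]"] norm_ge_zero order_trans by blast
    have "(\<Sum>\<alpha> | length \<alpha> = n. norm (R_term c lam p Q w F s \<alpha>)) \<le>
        (\<Sum>\<alpha> | length \<alpha> = n. norm (?K \<alpha>) * D * C)"
      unfolding R_term_def
      by (intro sum_mono order_trans[OF C(2)] mult_right_mono mult_left_mono F C(1)) auto
    also have "\<dots> = D * C * (\<Sum>\<alpha> | length \<alpha> = n. norm (?K \<alpha>))"
      by (simp add: sum_distrib_left mult_ac)
    also have "\<dots> \<le> D * C * g n"
      by (intro mult_left_mono g mult_nonneg_nonneg C D)
    finally show ?thesis .
  qed
  define T where "T F n = (\<Sum>\<alpha> | length \<alpha> = n. R_term c lam p Q w F s \<alpha>)" for F n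
  have T0: "T F 0 = F s" for F
    by (simp add: T_def R_term_def K_mat_Nil word_weight_Nil)
  define D where "D = B + (\<Sum>i\<in>UNIV. a * norm (E_mat i :: real ^ 'm ^ 'm) * C * norm Q * C * B * C)"
  \<comment> \<open>The recursion expresses \<open>G\<close> on the orbit of s through
    \<open>Z\<close> at the same point and at its successors, so the bounds \<open>B\<close> and
    \<open>a\<close> control \<open>G\<close> as well.\<close>
  have G_bound: "norm (G (?r \<alpha>)) \<le> D" for \<alpha>
  proof -
    have "norm (?A (?r \<alpha>) ** E_mat i ** Q ** Z (?r \<alpha> / p i))
        \<le> a * norm (E_mat i :: real ^ 'm ^ 'm) * C * norm Q * C * B * C" for i
    proof -
      have Zi: "norm (Z (?r \<alpha> / p i)) \<le> B"
        using bound[of "\<alpha> @ [i]"] by (simp add: word_weight_snoc)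
      have "norm (?A (?r \<alpha>) ** E_mat i) \<le> a * norm (E_mat i :: real ^ 'm ^ 'm) * C"
        by (rule order_trans[OF C(2)]) (intro mult_right_mono a norm_ge_zero C(1))
      from mult_right_mono[OF mult_right_mono[OF this norm_ge_zero] C(1)]
      have "norm (?A (?r \<alpha>) ** E_mat i ** Q) \<le> a * norm (E_mat i :: real ^ 'm ^ 'm) * C * norm Q * C"
        by (rule order_trans[OF C(2)])
      then show ?thesis
        by (intro order_trans[OF C(2) mult_right_mono[OF mult_mono[OF _ Zi] C(1)]])
           (auto intro!: mult_nonneg_nonneg simp: C(1) a0)
    qed
    then have "norm (\<Sum>i\<in>UNIV. ?A (?r \<alpha>) ** E_mat i ** Q ** Z (?r \<alpha> / p i))
      \<le> (\<Sum>i\<in>UNIV. a * norm (E_mat i :: real ^ 'm ^ 'm) * C * norm Q * C * B * C)"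
      by (rule sum_norm_le)
    moreover have "G (?r \<alpha>) = Z (?r \<alpha>) - (\<Sum>i\<in>UNIV. ?A (?r \<alpha>) ** E_mat i ** Q ** Z (?r \<alpha> / p i))"
      by (subst rec) auto
    ultimately show ?thesis
      unfolding D_def using bound[of \<alpha>]
      by (simp only:) (rule order_trans[OF norm_triangle_ineq4 add_mono])
  qed
  show "(\<lambda>\<alpha>. norm (R_term c lam p Q w G s \<alpha>)) summable_on X"
    by (rule summable_on_lists[OF _ summable_mult[OF g(1)] term_bound[where F=G, OF G_bound]]) simp
  \<comment> \<open>Distributing \<open>K_mat\<close> over the recursion splits the remainder at
    level n into the level-n part of the series and the remainder at level n + 1.\<close>
  have step: "T Z n = T G n + T Z (Suc n)" for n
  proof -
    have "R_term c lam p Q w Z s \<alpha> = R_term c lam p Q w G s \<alpha>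
        + (\<Sum>i\<in>UNIV. R_term c lam p Q w Z s (\<alpha> @ [i]))" for \<alpha>
    proof -
      have "R_term c lam p Q w Z s \<alpha> = ?K \<alpha> ** (G (?r \<alpha>)
          + (\<Sum>i\<in>UNIV. ?A (?r \<alpha>) ** E_mat i ** Q ** Z (?r \<alpha> / p i)))"
        unfolding R_term_def by (rule arg_cong[OF rec[OF refl]])
      also have "\<dots> = ?K \<alpha> ** G (?r \<alpha>)
          + (\<Sum>i\<in>UNIV. ?K \<alpha> ** (?A (?r \<alpha>) ** E_mat i ** Q) ** Z (?r \<alpha> / p i))"
        by (simp only: matrix_mult.add_right matrix_mult.sum_right matrix_mul_assoc)
      finally show ?thesis
        by (simp add: R_term_def K_mat_snoc word_weight_snoc)
    qed
    then show ?thesis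
      unfolding T_def sum_words_Suc sum.distrib[symmetric] by (intro sum.cong refl)
  qed
  have partial: "Z s = (\<Sum>k<n. T G k) + T Z n" for n
  proof (induction n)
    case (Suc n)
    then show ?case
      using step[of n] by (simp add: add.assoc)
  qed (simp add: T0)
  have "T Z \<longlonglongrightarrow> 0"
  proof (rule Lim_null_comparison)
    show "\<forall>\<^sub>F n in sequentially. norm (T Z n) \<le> B * C * g n"
      unfolding T_def
      by (intro always_eventually allI order_trans[OF norm_sum] term_bound[where F=Z, OF bound])
    show "(\<lambda>n. B * C * g n) \<longlonglongrightarrow> 0"
      using summable_LIMSEQ_zero[OF g(1)] tendsto_mult_right_zero by blast
  qed
  then have "(\<lambda>n. Z s - T Z n) \<longlonglongrightarrow> Z s - 0"
    by (intro tendsto_intros)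
  moreover have "(\<lambda>n. Z s - T Z n) = (\<lambda>n. \<Sum>k<n. T G k)"
    using partial by (auto simp: fun_eq_iff algebra_simps)
  ultimately have "T G sums Z s"
    by (simp add: sums_def)
  \<comment> \<open>The empty word contributes \<open>G s\<close>, which \<open>R_op\<close> writes
    separately; its series starts with words of length 1.\<close>
  then have "(\<lambda>n. T G (Suc n)) sums (Z s - G s)"
    by (subst sums_Suc_iff) (simp add: T0)
  then show "Z s = R_op c lam p Q w G s"
    by (simp add: R_op_def T_def sums_iff)
qed

section \<open>The process\<close>

text \<open>The first passage functional involves an infimum over uncountably many times. Its
  measurability is inherited from a functional of the jump chain that agrees with it almost
  everywhere.\<close>

lemma (in complete_measure) measurable_AE:
  assumes f: "f \<in> M \<rightarrow>\<^sub>M N" and AE: "AE x in M. f x = g x"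
    and g: "g \<in> space M \<rightarrow> space N"
  shows "g \<in> M \<rightarrow>\<^sub>M N"
proof (rule measurableI)
  fix A assume "A \<in> sets N"
  then have A: "f -` A \<inter> space M \<in> sets M"
    by (rule measurable_sets[OF f])
  show "g -` A \<inter> space M \<in> sets M"
    by (rule in_sets_AE[OF _ A]) (use AE in \<open>auto elim: AE_mp\<close>)
qed (use g in auto)

locale passage_model =
  fixes c lam p :: "'m::finite \<Rightarrow> real" and Q :: "real ^ 'm ^ 'm" and w b :: real
  assumes c_pos: "\<And>i. c i > 0" and lam_pos: "\<And>i. lam i > 0"
    and p_pos: "\<And>i. 0 < p i" and p_less_1: "\<And>i. p i < 1"
    and stochastic: "stochastic_matrix Q" and w_pos: "w > 0" and b_pos: "b > 0"
begin

abbreviation "z \<equiv> zpar c lam w"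

abbreviation "S \<equiv> stream_space (innovation Q)"

lemma Q_nonneg: "0 \<le> Q $ i $ j"
  using stochastic by (simp add: stochastic_matrix_def)

lemma Q_sum: "(\<Sum>j\<in>UNIV. Q $ i $ j) = 1"
  using stochastic by (simp add: stochastic_matrix_def)

lemma z_pos: "0 < z i"
  using c_pos lam_pos w_pos by (simp add: zpar_def add_pos_pos)

subsection \<open>First passage at the jump times\<close>

definition hit :: "real \<Rightarrow> 'm \<Rightarrow> (real \<times> ('m \<Rightarrow> 'm)) stream \<Rightarrow> bool" where
  "hit x i \<omega> \<longleftrightarrow> (\<exists>n. jump_level c lam p x i \<omega> n \<le> b)"

definition hit_index :: "real \<Rightarrow> 'm \<Rightarrow> (real \<times> ('m \<Rightarrow> 'm)) stream \<Rightarrow> nat" where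
  "hit_index x i \<omega> = (LEAST n. jump_level c lam p x i \<omega> n \<le> b)"

text \<open>The integrand of \<open>Z_down\<close> with continuous time replaced by the jump chain:
  only the levels right after jumps are inspected, so measurability reduces to countable
  operations.\<close>

definition discount :: "'m \<Rightarrow> 'm \<Rightarrow> real \<Rightarrow> (real \<times> ('m \<Rightarrow> 'm)) stream \<Rightarrow> real" where
  "discount i j x \<omega> =
     (if hit x i \<omega> \<and> phase i \<omega> (hit_index x i \<omega>) = j
      then exp (- w * jump_time lam i \<omega> (hit_index x i \<omega>)) else 0)"

section \<open>Effect of removing the first innovation\<close>

lemma phase_Stream: "phase i (a ## \<omega>) (Suc n) = phase (snd a i) \<omega> n"
  by (induction n) auto

lemma holding_time_Stream:
  "holding_time lam i (a ## \<omega>) (Suc n) = holding_time lam (snd a i) \<omega> n"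
  by (simp add: holding_time_def phase_Stream del: phase.simps(2))

lemma jump_time_Stream:
  "jump_time lam i (a ## \<omega>) (Suc n) = fst a / lam i + jump_time lam (snd a i) \<omega> n"
proof -
  have "jump_time lam i (a ## \<omega>) (Suc n) =
      holding_time lam i (a ## \<omega>) 0 + (\<Sum>k<n. holding_time lam i (a ## \<omega>) (Suc k))"
    unfolding jump_time_def by (rule sum.lessThan_Suc_shift)
  then show ?thesis
    by (simp add: holding_time_Stream jump_time_def) (simp add: holding_time_def)
qed

lemma jump_level_Stream:
  "jump_level c lam p x i (a ## \<omega>) (Suc n) =
     jump_level c lam p (p i * (x + fst a / (lam i * c i))) (snd a i) \<omega> n"
proof (induction n)
  case 0
  show ?case by (simp add: holding_time_def)
next
  case (Suc n)
  show ?case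
    by (subst jump_level.simps(2), subst Suc)
       (simp only: phase_Stream holding_time_Stream jump_level.simps(2))
qed

lemma discount_below: "x \<le> b \<Longrightarrow> discount i j x \<omega> = (if i = j then 1 else 0)"
proof -
  assume x: "x \<le> b"
  then have "hit_index x i \<omega> = 0"
    unfolding hit_index_def by (intro Least_equality) auto
  moreover have "hit x i \<omega>"
    unfolding hit_def using x by (intro exI[of _ 0]) simp
  ultimately show ?thesis
    by (auto simp: discount_def jump_time_def)
qed

text \<open>Pathwise first-step decomposition. Since x > b, index 0 is no hit, so the hitting index
  is one more than that of the shifted path started at the level and phase after the first
  jump.\<close>

lemma discount_above:
  assumes "b < x"
  shows "discount i j x (a ## \<omega>) = exp (- w * (fst a / lam i))
     * discount (snd a i) j (p i * (x + fst a / (lam i * c i))) \<omega>"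
proof -
  let ?x = "p i * (x + fst a / (lam i * c i))" and ?i = "snd a i"
  have hit: "hit x i (a ## \<omega>) \<longleftrightarrow> hit ?x ?i \<omega>"
    unfolding hit_def
    by (metis assms jump_level.simps(1) jump_level_Stream not_less old.nat.exhaust)
  show ?thesis
  proof (cases "hit ?x ?i \<omega>")
    case True
    then obtain n where "jump_level c lam p ?x ?i \<omega> n \<le> b"
      by (auto simp: hit_def)
    then have "hit_index x i (a ## \<omega>) = Suc (hit_index ?x ?i \<omega>)"
      unfolding hit_index_def using assms
      by (subst Least_Suc[of _ "Suc n"])
         (simp_all add: jump_level_Stream del: jump_level.simps(2))
    with True hit show ?thesis
      by (simp add: discount_def jump_time_Stream phase_Stream algebra_simps
            flip: exp_add del: phase.simps(2))
  qed (simp add: discount_def hit)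
qed

lemma discount_nonneg: "0 \<le> discount i j x \<omega>"
  by (simp add: discount_def)

subsection \<open>The innovations\<close>

lemma prob_space_innovation: "prob_space (innovation Q)"
proof -
  interpret E: prob_space "density lborel (exponential_density 1)"
    by (rule prob_space_exponential_density) simp
  interpret P: pair_prob_space "density lborel (exponential_density 1)"
    "measure_pmf (Pi_pmf UNIV undefined (phase_step Q))" ..
  show ?thesis unfolding innovation_def by (rule P.prob_space_axioms)
qed

sublocale innov: prob_space "innovation Q"
  by (rule prob_space_innovation)

sublocale path: prob_space S
  by (rule innov.prob_space_stream_space)

lemma sets_innovation [measurable_cong]:
  "sets (innovation Q) = sets (borel \<Otimes>\<^sub>M count_space UNIV)"
  unfolding innovation_def by (intro sets_pair_measure_cong) auto

text \<open>Tonelli separates the exponential variable from the random map. Only the value of the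
  map at i enters, and its marginal under the product law is row i of \<open>Q\<close>.\<close>

lemma nn_integral_innovation:
  assumes [measurable]: "\<And>k. (\<lambda>e. h e k) \<in> borel_measurable borel"
  shows "(\<integral>\<^sup>+a. h (fst a) (snd a i) \<partial>innovation Q) =
    (\<integral>\<^sup>+e. exponential_density 1 e * (\<Sum>k\<in>UNIV. ennreal (Q $ i $ k) * h e k) \<partial>lborel)"
proof -
  let ?P = "Pi_pmf UNIV undefined (phase_step Q)"
  let ?D = "density lborel (exponential_density 1)"
  interpret D: prob_space ?D
    by (rule prob_space_exponential_density) simp
  have m [measurable]: "(\<lambda>a. h (fst a) (snd a i)) \<in> borel_measurable (borel \<Otimes>\<^sub>M count_space UNIV)"
  proof -
    have "(\<lambda>a. h (fst a) ((\<lambda>f. f i) (snd a)))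
        \<in> borel_measurable (borel \<Otimes>\<^sub>M count_space UNIV)"
    proof (rule measurable_compose_countable[where f="\<lambda>k a. h (fst a) k"])
      show "(\<lambda>a. (\<lambda>f. f i) (snd a)) \<in> borel \<Otimes>\<^sub>M count_space UNIV \<rightarrow>\<^sub>M count_space UNIV"
        by (rule measurable_compose[OF measurable_snd]) simp
    qed measurable
    then show ?thesis by simp
  qed
  have "(\<integral>\<^sup>+a. h (fst a) (snd a i) \<partial>innovation Q) = (\<integral>\<^sup>+e. \<integral>\<^sup>+f. h e (f i) \<partial>?P \<partial>?D)"
    unfolding innovation_def
    by (subst measure_pmf.nn_integral_fst[symmetric]) (auto intro!: measurable_pair_measureI)
  also have "\<dots> = (\<integral>\<^sup>+e. (\<Sum>k\<in>UNIV. ennreal (Q $ i $ k) * h e k) \<partial>?D)"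
  proof (rule nn_integral_cong)
    fix e
    have "(\<integral>\<^sup>+f. h e (f i) \<partial>?P) = (\<integral>\<^sup>+k. h e k \<partial>map_pmf (\<lambda>f. f i) ?P)"
      by simp
    also have "\<dots> = (\<integral>\<^sup>+k. h e k \<partial>phase_step Q i)"
      by (subst Pi_pmf_component) auto
    also have "\<dots> = (\<Sum>k\<in>UNIV. ennreal (Q $ i $ k) * h e k)"
      by (simp add: nn_integral_measure_pmf nn_integral_count_space_finite
            pmf_phase_step[OF stochastic])
    finally show "(\<integral>\<^sup>+f. h e (f i) \<partial>?P) = (\<Sum>k\<in>UNIV. ennreal (Q $ i $ k) * h e k)" .
  qed
  also have "\<dots> = (\<integral>\<^sup>+e. exponential_density 1 e
      * (\<Sum>k\<in>UNIV. ennreal (Q $ i $ k) * h e k) \<partial>lborel)"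
    by (subst nn_integral_density) auto
  finally show ?thesis .
qed

lemma AE_innovation_pos: "AE a in innovation Q. 0 < fst a"
proof -
  have "(\<integral>\<^sup>+a. indicator {..0} (fst a) \<partial>innovation Q) = 0"
  proof -
    have "AE e in lborel. (e::real) \<noteq> 0" by (rule AE_lborel_singleton)
    then have "AE e in lborel. ennreal (exponential_density 1 e)
        * (\<Sum>k\<in>UNIV. ennreal (Q $ i $ k) * indicator {..0} e) = 0" for i
      by eventually_elim (auto simp: exponential_density_def indicator_def)
    then show ?thesis
      by (subst nn_integral_innovation[where h="\<lambda>e k. indicator {..0} e"])
         (auto simp: nn_integral_0_iff_AE)
  qed
  then have "AE a in innovation Q. (indicator {..0} (fst a) :: ennreal) = 0"
    by (subst (asm) nn_integral_0_iff_AE) auto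
  then show ?thesis
    by eventually_elim (auto simp: indicator_def split: if_splits)
qed

lemma nn_integral_exp_innovation: "(\<integral>\<^sup>+a. ennreal (exp (- fst a)) \<partial>innovation Q) = ennreal (1/2)"
proof -
  have Q1: "(\<Sum>k\<in>UNIV. ennreal (Q $ i $ k)) = 1" for i
    by (simp add: sum_ennreal Q_nonneg Q_sum)
  \<comment> \<open>The integrand ignores the phase, so the row of \<open>Q\<close> is arbitrary and
    \<open>undefined\<close> serves as its index. The remaining integral is the Laplace transform of
    the standard exponential law at 1.\<close>
  have "(\<integral>\<^sup>+a. ennreal (exp (- fst a)) \<partial>innovation Q) =
     (\<integral>\<^sup>+e. exponential_density 1 e * (\<Sum>k\<in>UNIV. ennreal (Q $ undefined $ k) * ennreal (exp (-e))) \<partial>lborel)"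
    by (rule nn_integral_innovation) auto
  also have "\<dots> = (\<integral>\<^sup>+e. ennreal (1/2) * ennreal (exponential_density 2 e) \<partial>lborel)"
  proof (rule nn_integral_cong)
    fix e :: real
    have "exponential_density 1 e * exp (- e) = 1/2 * exponential_density 2 e"
      by (simp add: exponential_density_def flip: exp_add)
    then show "ennreal (exponential_density 1 e)
        * (\<Sum>k\<in>UNIV. ennreal (Q $ undefined $ k) * ennreal (exp (- e)))
      = ennreal (1/2) * ennreal (exponential_density 2 e)"
      unfolding sum_distrib_right[symmetric] Q1 mult_1
      by (metis ennreal_mult' exp_ge_zero ennreal_mult'' exponential_density_nonneg zero_less_numeral)
  qed
  also have "\<dots> = ennreal (1/2) * (\<integral>\<^sup>+e. ennreal (exponential_density 2 e) \<partial>lborel)"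
    by (rule nn_integral_cmult) auto
  also have "(\<integral>\<^sup>+e. ennreal (exponential_density 2 e) \<partial>lborel) = 1"
    using prob_space.emeasure_space_1[OF prob_space_exponential_density[of 2]]
    by (simp add: emeasure_density)
  finally show ?thesis by simp
qed

lemma nn_integral_exp_sum:
  "(\<integral>\<^sup>+\<omega>. ennreal (exp (- (\<Sum>k<n. fst (\<omega> !! k)))) \<partial>S) = ennreal (1/2) ^ n"
proof (induction n)
  case 0
  show ?case using path.emeasure_space_1 by simp
next
  case (Suc n)
  have "(\<integral>\<^sup>+\<omega>. ennreal (exp (- (\<Sum>k<Suc n. fst (\<omega> !! k)))) \<partial>S) =
    (\<integral>\<^sup>+a. \<integral>\<^sup>+\<omega>. ennreal (exp (- fst a)) * ennreal (exp (- (\<Sum>k<n. fst (\<omega> !! k)))) \<partial>S \<partial>innovation Q)"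
    by (subst innov.nn_integral_stream_space)
       (auto simp: sum.lessThan_Suc_shift exp_add[symmetric] ennreal_mult[symmetric] simp del: sum.lessThan_Suc)
  also have "\<dots> = (\<integral>\<^sup>+a. ennreal (exp (- fst a)) * ennreal (1/2) ^ n \<partial>innovation Q)"
    by (intro nn_integral_cong, subst nn_integral_cmult) (auto simp: Suc)
  also have "\<dots> = ennreal (1/2) ^ Suc n"
    by (subst nn_integral_multc) (auto simp: nn_integral_exp_innovation)
  finally show ?case .
qed

text \<open>A Markov-type bound: on the event that all partial sums stay below t, exp (- t) is at
  most exp of minus the n-th sum, whose mean is 2^-n. Letting n grow shows that the event is
  null.\<close>

lemma AE_nonexplosive: "AE \<omega> in S. \<forall>t. \<exists>n. t < (\<Sum>k<n. fst (\<omega> !! k))"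
proof -
  \<comment> \<open>Natural t suffice by the Archimedean property, and they allow a countable
    intersection of almost sure events.\<close>
  have "AE \<omega> in S. \<exists>n. real t < (\<Sum>k<n. fst (\<omega> !! k))" for t :: nat
  proof -
    let ?N = "{\<omega> \<in> space S. \<forall>n. (\<Sum>k<n. fst (\<omega> !! k)) \<le> real t}"
    have [measurable]: "?N \<in> sets S" by measurable
    have le: "ennreal (exp (- real t)) * emeasure S ?N \<le> ennreal ((1/2) ^ n)" for n
    proof -
      have "ennreal (exp (- real t)) * emeasure S ?N = (\<integral>\<^sup>+\<omega>. ennreal (exp (- real t)) * indicator ?N \<omega> \<partial>S)"
        by (simp add: nn_integral_cmult_indicator)
      also have "\<dots> \<le> (\<integral>\<^sup>+\<omega>. ennreal (exp (- (\<Sum>k<n. fst (\<omega> !! k)))) \<partial>S)"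
        by (intro nn_integral_mono) (auto simp: indicator_def intro!: ennreal_leI)
      also have "\<dots> = ennreal ((1/2) ^ n)"
        unfolding nn_integral_exp_sum by (rule ennreal_power) simp
      finally show ?thesis .
    qed
    have lim: "(\<lambda>n. ennreal ((1/2) ^ n)) \<longlonglongrightarrow> ennreal 0"
      by (intro tendsto_ennrealI LIMSEQ_power_zero) auto
    have "ennreal (exp (- real t)) * emeasure S ?N \<le> ennreal 0"
      by (rule LIMSEQ_le_const[OF lim]) (auto intro: le)
    then have "emeasure S ?N = 0" by (simp add: ennreal_eq_0_iff)
    then have "?N \<in> null_sets S" by auto
    then show ?thesis
      by (rule AE_I') (auto simp: not_less)
  qed
  then have "AE \<omega> in S. \<forall>t::nat. \<exists>n. real t < (\<Sum>k<n. fst (\<omega> !! k))"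
    by (simp add: AE_all_countable)
  then show ?thesis
    by eventually_elim (meson le_less_trans real_arch_simple)
qed

section \<open>Measurability of the jump chain and its functionals\<close>

lemma phase_measurable [measurable]: "(\<lambda>\<omega>. phase i \<omega> n) \<in> S \<rightarrow>\<^sub>M count_space UNIV"
proof (induction n)
  case (Suc n)
  have "(\<lambda>\<omega>. (\<lambda>f. f k) (snd (\<omega> !! n))) \<in> S \<rightarrow>\<^sub>M count_space UNIV" for k
  proof -
    have "snd \<in> innovation Q \<rightarrow>\<^sub>M count_space UNIV" by measurable
    then have "(\<lambda>\<omega>. snd (\<omega> !! n)) \<in> S \<rightarrow>\<^sub>M count_space UNIV"
      by (rule measurable_compose[OF measurable_snth])
    from measurable_compose[OF this, of "\<lambda>f. f k" "count_space UNIV"] show ?thesis by simp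
  qed
  then show ?case
    by (auto intro: measurable_compose_countable[where f="\<lambda>k \<omega>. snd (\<omega> !! n) k"] Suc)
qed simp

lemma holding_time_measurable [measurable]: "(\<lambda>\<omega>. holding_time lam i \<omega> n) \<in> borel_measurable S"
  unfolding holding_time_def
  by (intro borel_measurable_divide) (auto intro: measurable_compose[OF phase_measurable])

lemma jump_time_measurable [measurable]: "(\<lambda>\<omega>. jump_time lam i \<omega> n) \<in> borel_measurable S"
  unfolding jump_time_def by measurable

lemma jump_level_measurable [measurable]:
  "(\<lambda>(x, \<omega>). jump_level c lam p x i \<omega> n) \<in> borel_measurable (borel \<Otimes>\<^sub>M S)"
proof (induction n)
  case (Suc n)
  have [measurable]: "(\<lambda>\<omega>. h (phase i \<omega> n)) \<in> borel_measurable S" for h :: "'m \<Rightarrow> real"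
    by (rule measurable_compose[OF phase_measurable]) simp
  note Suc[measurable]
  show ?case
    by (simp add: case_prod_beta') measurable
qed simp

text \<open>Joint measurability in the starting level and the path makes the expectation a
  measurable function of the level, as the Laplace transform requires.\<close>

lemma discount_measurable [measurable]:
  "(\<lambda>(x, \<omega>). discount i j x \<omega>) \<in> borel_measurable (borel \<Otimes>\<^sub>M S)"
proof -
  have level [measurable]: "(\<lambda>y. jump_level c lam p (fst y) i (snd y) n)
      \<in> borel_measurable (borel \<Otimes>\<^sub>M S)" for n
    using jump_level_measurable[of i n] by (simp add: case_prod_beta')
  have [measurable]: "Measurable.pred (borel \<Otimes>\<^sub>M S) (\<lambda>y. hit (fst y) i (snd y))"
    unfolding hit_def by measurable
  have idx [measurable]: "(\<lambda>y. hit_index (fst y) i (snd y)) \<in> borel \<Otimes>\<^sub>M S \<rightarrow>\<^sub>M count_space UNIV"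
    unfolding hit_index_def by measurable
  have [measurable]: "(\<lambda>y. phase i (snd y) (hit_index (fst y) i (snd y)))
      \<in> borel \<Otimes>\<^sub>M S \<rightarrow>\<^sub>M count_space UNIV"
    by (rule measurable_compose_countable[OF _ idx]) measurable
  have [measurable]: "(\<lambda>y. jump_time lam i (snd y) (hit_index (fst y) i (snd y)))
      \<in> borel_measurable (borel \<Otimes>\<^sub>M S)"
    by (rule measurable_compose_countable[OF _ idx]) measurable
  show ?thesis
    unfolding discount_def case_prod_beta' by measurable
qed

text \<open>Outside an exceptional null set the jump times increase strictly to infinity, so
  \<open>X\<close> first reaches \<open>(-\<infinity>, b]\<close> at a jump time.\<close>

lemma passage_functional_eq_discount:
  assumes pos: "\<And>k. 0 < fst (\<omega> !! k)" and nonexplosive: "\<And>t. \<exists>n. t < (\<Sum>k<n. fst (\<omega> !! k))"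
  shows "(let T = passage_times c lam p b x i \<omega>; \<tau> = Inf T
         in if T \<noteq> {} \<and> J_process lam i \<omega> \<tau> = j then exp (- w * \<tau>) else 0) = discount i j x \<omega>"
proof -
  let ?T = "jump_time lam i \<omega>" and ?L = "jump_level c lam p x i \<omega>" and ?N = "jump_count lam i \<omega>"
  have hold: "0 < holding_time lam i \<omega> k" for k
    using pos lam_pos by (simp add: holding_time_def)
  have step: "?T n < ?T (Suc n)" for n
    using hold by (simp add: jump_time_def)
  then have mono: "strict_mono ?T" by (simp add: strict_mono_Suc_iff)
  have T0: "?T 0 = 0" by (simp add: jump_time_def)
  \<comment> \<open>A common upper bound on the rates bounds jump times below by sums of innovations
    divided by \<open>l\<close>, which transfers nonexplosion.\<close>
  obtain l where l: "l > 0" "\<And>i. lam i \<le> l"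
    using lam_pos by (metis Max_ge finite finite_imageI imageI less_le_trans UNIV_I)
  have unbounded: "\<exists>n. t < ?T n" for t
  proof -
    obtain n where "t * l < (\<Sum>k<n. fst (\<omega> !! k))" using nonexplosive by blast
    moreover have "(\<Sum>k<n. fst (\<omega> !! k)) / l \<le> ?T n"
      unfolding jump_time_def holding_time_def sum_divide_distrib
      by (intro sum_mono divide_left_mono) (auto simp: l lam_pos less_imp_le[OF pos])
    ultimately show ?thesis
      using l(1) by (meson less_le_trans pos_less_divide_eq)
  qed
  have count: "?T (?N t) \<le> t \<and> t < ?T (Suc (?N t))" if "0 \<le> t" for t
  proof
    obtain n where "t < ?T (Suc n)"
      using unbounded[of t] step by (meson less_trans)
    then show "t < ?T (Suc (?N t))"
      unfolding jump_count_def by (rule LeastI)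
    show "?T (?N t) \<le> t"
    proof (cases "?N t")
      case 0
      with that T0 show ?thesis by simp
    next
      case (Suc n)
      then have "\<not> t < ?T (Suc n)"
        unfolding jump_count_def by (metis lessI not_less_Least)
      with Suc show ?thesis by simp
    qed
  qed
  have T_nonneg: "0 \<le> ?T n" for n
    using mono T0 by (metis le0 strict_mono_less_eq)
  \<comment> \<open>The strict inequality in \<open>jump_count\<close> counts a jump already at its
    own time, so the process at \<open>?T n\<close> sits at the level and phase after the
    jump.\<close>
  have count_T: "?N (?T n) = n" for n
  proof -
    have "?T (?N (?T n)) \<le> ?T n" "?T n < ?T (Suc (?N (?T n)))"
      using count[OF T_nonneg] by auto
    then have "?N (?T n) \<le> n" "n < Suc (?N (?T n))"
      using mono by (simp_all add: strict_mono_less_eq strict_mono_less)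
    then show ?thesis by simp
  qed
  \<comment> \<open>The level rises between jumps; if it is at most b at some time, it was so right
    after the latest jump (or at time 0).\<close>
  have X_ge: "?L (?N t) \<le> X_process c lam p x i \<omega> t" if "0 \<le> t" for t
    using count[OF that] c_pos by (simp add: X_process_def Let_def less_imp_le)
  have X_T: "X_process c lam p x i \<omega> (?T n) = ?L n" for n
    by (simp add: X_process_def Let_def count_T)
  let ?P = "passage_times c lam p b x i \<omega>"
  show ?thesis
  proof (cases "hit x i \<omega>")
    case True
    let ?n = "hit_index x i \<omega>"
    have Ln: "?L ?n \<le> b"
      using True unfolding hit_def hit_index_def by (rule LeastI_ex)
    have mem: "?T ?n \<in> ?P"
      using Ln by (simp add: passage_times_def X_T T_nonneg)
    have "Inf ?P = ?T ?n"
    proof (rule cInf_eq_minimum[OF mem])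
      fix t assume "t \<in> ?P"
      then have t: "0 \<le> t" "?L (?N t) \<le> b"
        using X_ge[of t] by (auto simp: passage_times_def)
      then have "?n \<le> ?N t"
        unfolding hit_index_def by (intro Least_le)
      then show "?T ?n \<le> t"
        using count[OF t(1)] mono by (meson order_trans strict_mono_less_eq)
    qed
    with mem True show ?thesis
      by (auto simp: discount_def J_process_def count_T Let_def)
  next
    case False
    then have "t \<notin> ?P" for t
      using X_ge[of t] by (auto simp: passage_times_def hit_def dest: order_trans)
    then have "?P = {}" by blast
    with False show ?thesis by (simp add: discount_def)
  qed
qed

lemma discount_le_1:
  assumes "\<And>k. 0 < fst (\<omega> !! k)"
  shows "discount i j x \<omega> \<le> 1"
proof -
  have "0 \<le> jump_time lam i \<omega> n" for n
    unfolding jump_time_def holding_time_def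
    by (intro sum_nonneg divide_nonneg_nonneg) (auto simp: less_imp_le lam_pos assms)
  then show ?thesis using w_pos by (simp add: discount_def)
qed

lemma AE_path_pos: "AE \<omega> in S. \<forall>k. 0 < fst (\<omega> !! k)"
proof -
  have "AE \<omega> in S. stream_all (\<lambda>a. 0 < fst a) \<omega>"
    by (rule innov.AE_stream_all[OF _ AE_innovation_pos]) measurable
  then show ?thesis
    by eventually_elim (auto simp: stream.pred_set)
qed

subsection \<open>The renewal equation\<close>

text \<open>Expectation in \<open>ennreal\<close>, where conditioning and Tonelli carry no
  integrability conditions; the bound by 1 then permits passage to the real-valued
  \<open>U\<close>.\<close>

definition U_nn :: "'m \<Rightarrow> 'm \<Rightarrow> real \<Rightarrow> ennreal" where
  "U_nn i j x = (\<integral>\<^sup>+\<omega>. ennreal (discount i j x \<omega>) \<partial>S)"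

definition U :: "'m \<Rightarrow> 'm \<Rightarrow> real \<Rightarrow> real" where
  "U i j x = enn2real (U_nn i j x)"

lemma U_nn_measurable [measurable]: "U_nn i j \<in> borel_measurable borel"
proof -
  have [measurable]: "(\<lambda>y. discount i j (fst y) (snd y)) \<in> borel_measurable (borel \<Otimes>\<^sub>M S)"
    using discount_measurable[of i j] by (simp add: case_prod_beta')
  show ?thesis
    unfolding U_nn_def[abs_def]
    by (rule path.borel_measurable_nn_integral) (simp add: case_prod_beta')
qed

lemma U_nn_le_1: "U_nn i j x \<le> 1"
proof -
  have "U_nn i j x \<le> (\<integral>\<^sup>+\<omega>. 1 \<partial>S)"
    unfolding U_nn_def using AE_path_pos
    by (intro nn_integral_mono_AE) (auto elim!: eventually_mono simp: discount_le_1)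
  then show ?thesis using path.emeasure_space_1 by simp
qed

lemma U_nn_eq: "U_nn i j x = ennreal (U i j x)"
  unfolding U_def using U_nn_le_1[of i j x]
  by (metis ennreal_enn2real ennreal_one_less_top le_less_trans)

lemma U_measurable [measurable]: "U i j \<in> borel_measurable borel"
  unfolding U_def[abs_def] by measurable

lemma U_nonneg: "0 \<le> U i j x"
  by (simp add: U_def)

lemma U_le_1: "U i j x \<le> 1"
  using U_nn_le_1[of i j x] by (simp add: U_nn_eq)

text \<open>The passage integrand equals \<open>discount\<close> off a null set. Completeness of
  \<open>path_space\<close> makes it measurable, and the completion does not change the integral of
  \<open>discount\<close>.\<close>

lemma Z_down_eq_U: "Z_down c lam p Q w x b $ i $ j = U i j x"
proof -
  let ?F = "\<lambda>\<omega>. let T = passage_times c lam p b x i \<omega>; \<tau> = Inf T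
         in if T \<noteq> {} \<and> J_process lam i \<omega> \<tau> = j then exp (- w * \<tau>) else 0"
  have [measurable]: "discount i j x \<in> borel_measurable S"
    using measurable_compose_Pair1[OF _ discount_measurable[of i j], of x] by simp
  have AE: "AE \<omega> in S. discount i j x \<omega> = ?F \<omega>"
    using AE_path_pos AE_nonexplosive
    by eventually_elim (rule passage_functional_eq_discount[symmetric]; blast)
  have m: "discount i j x \<in> borel_measurable (path_space Q)"
    unfolding path_space_def by (intro measurable_completion) simp
  have "Z_down c lam p Q w x b $ i $ j = (\<integral>\<omega>. ?F \<omega> \<partial>path_space Q)"
    by (simp add: Z_down_def)
  also have "\<dots> = (\<integral>\<omega>. discount i j x \<omega> \<partial>path_space Q)"
  proof (rule integral_cong_AE)
    show "?F \<in> borel_measurable (path_space Q)"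
      unfolding path_space_def
      by (rule completion.measurable_AE[OF m[unfolded path_space_def] AE_completion[OF AE]]) simp
    show "AE \<omega> in path_space Q. ?F \<omega> = discount i j x \<omega>"
      unfolding path_space_def using AE by (intro AE_completion) (auto elim: eventually_mono)
  qed (rule m)
  also have "\<dots> = (\<integral>\<omega>. discount i j x \<omega> \<partial>S)"
    unfolding path_space_def by (rule integral_completion) simp
  also have "\<dots> = U i j x"
    by (simp add: integral_eq_nn_integral discount_nonneg U_def U_nn_def)
  finally show ?thesis .
qed

lemma U_below: "x \<le> b \<Longrightarrow> U i j x = (if i = j then 1 else 0)"
  using path.emeasure_space_1 by (simp add: U_def U_nn_def discount_below)

definition V :: "'m \<Rightarrow> 'm \<Rightarrow> real \<Rightarrow> real" where
  "V i j y = (\<Sum>k\<in>UNIV. Q $ i $ k * U k j y)"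

lemma V_measurable [measurable]: "V i j \<in> borel_measurable borel"
  unfolding V_def[abs_def] by measurable

lemma V_nonneg: "0 \<le> V i j y"
  unfolding V_def by (intro sum_nonneg mult_nonneg_nonneg Q_nonneg U_nonneg)

lemma V_le_1: "V i j y \<le> 1"
proof -
  have "V i j y \<le> (\<Sum>k\<in>UNIV. Q $ i $ k * 1)"
    unfolding V_def by (intro sum_mono mult_left_mono U_le_1 Q_nonneg)
  then show ?thesis by (simp add: Q_sum)
qed

text \<open>Condition on the first innovation, then integrate over the level y after the jump
  instead of the exponential variable e. The Jacobian is \<gamma>_i, and density and discount merge
  into one exponential with rate z_i.\<close>

lemma first_step:
  assumes x: "b < x"
  shows "ennreal (U i j x) = (\<integral>\<^sup>+y. ennreal (indicator {p i * x..} y *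
    (gpar c lam p i * exp (- z i * (y / p i - x)) * V i j y)) \<partial>lborel)"
proof -
  let ?x = "\<lambda>e. p i * (x + e / (lam i * c i))"
  let ?t = "lam i * c i"
  have pos [simp]: "0 < p i" "0 < lam i" "0 < c i" using p_pos lam_pos c_pos by auto
  have [measurable]: "discount k j y \<in> borel_measurable S" for k y
    using measurable_compose_Pair1[OF _ discount_measurable[of k j], of y] by simp
  have "U_nn i j x = (\<integral>\<^sup>+a. \<integral>\<^sup>+\<omega>. ennreal (discount i j x (a ## \<omega>)) \<partial>S \<partial>innovation Q)"
    unfolding U_nn_def by (rule innov.nn_integral_stream_space) simp
  also have "\<dots> = (\<integral>\<^sup>+a. ennreal (exp (- w * (fst a / lam i)) * U (snd a i) j (?x (fst a))) \<partial>innovation Q)"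
    by (intro nn_integral_cong)
       (simp add: discount_above[OF x] ennreal_mult nn_integral_cmult discount_nonneg U_nonneg
          flip: U_nn_eq, simp add: U_nn_def)
  also have "\<dots> = (\<integral>\<^sup>+e. exponential_density 1 e *
      (\<Sum>k\<in>UNIV. ennreal (Q $ i $ k) * ennreal (exp (- w * (e / lam i)) * U k j (?x e))) \<partial>lborel)"
    by (rule nn_integral_innovation) measurable
  also have "\<dots> = (\<integral>\<^sup>+e. ennreal (exponential_density 1 e * (exp (- w * (e / lam i)) * V i j (?x e))) \<partial>lborel)"
    by (intro nn_integral_cong)
       (simp add: V_def ennreal_mult[symmetric] sum_ennreal sum_nonneg Q_nonneg U_nonneg
          exponential_density_nonneg sum_distrib_left mult_ac del: ennreal_mult)
  \<comment> \<open>Affine substitution e = \<open>?t * (y / p i - x)\<close>, obtained by solving y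
    = \<open>p i * (x + e / ?t)\<close> for e.\<close>
  also have "\<dots> = \<bar>?t / p i\<bar> * (\<integral>\<^sup>+y. ennreal (exponential_density 1 (- ?t * x + ?t / p i * y)
      * (exp (- w * ((- ?t * x + ?t / p i * y) / lam i)) * V i j (?x (- ?t * x + ?t / p i * y)))) \<partial>lborel)"
    by (rule nn_integral_real_affine) (auto simp: less_imp_neq[symmetric])
  also have "\<dots> = (\<integral>\<^sup>+y. ennreal (?t / p i) * ennreal (exponential_density 1 (- ?t * x + ?t / p i * y)
      * (exp (- w * ((- ?t * x + ?t / p i * y) / lam i)) * V i j (?x (- ?t * x + ?t / p i * y)))) \<partial>lborel)"
    by (subst nn_integral_cmult) (auto simp: abs_of_pos)
  also have "\<dots> = (\<integral>\<^sup>+y. ennreal (indicator {p i * x..} y *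
    (gpar c lam p i * exp (- z i * (y / p i - x)) * V i j y)) \<partial>lborel)"
  proof (rule nn_integral_cong)
    fix y
    let ?e = "- ?t * x + ?t / p i * y"
    have e: "?e = ?t * (y / p i - x)" by (simp add: algebra_simps)
    \<comment> \<open>The exponential density vanishes for e < 0, which becomes the lower limit
      \<open>p i * x\<close> in y.\<close>
    have e0: "?e < 0 \<longleftrightarrow> y < p i * x"
      unfolding e by (auto simp: mult_less_0_iff pos_divide_less_eq mult.commute less_not_sym[OF pos(2)] less_not_sym[OF pos(3)])
    have "p i \<noteq> 0" "lam i \<noteq> 0" "c i \<noteq> 0"
      using pos by (metis less_irrefl)+
    then have "?x ?e = y" and hold: "?e / lam i = c i * (y / p i - x)"
      unfolding e by (simp add: field_simps, simp)
    moreover have "exp (- ?e) * exp (- w * (?e / lam i)) = exp (- z i * (y / p i - x))"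
      unfolding hold unfolding e exp_add[symmetric] by (simp add: zpar_def algebra_simps)
    ultimately have "?t / p i * (exponential_density 1 ?e * (exp (- w * (?e / lam i)) * V i j (?x ?e)))
      = indicator {p i * x..} y * (gpar c lam p i * exp (- z i * (y / p i - x)) * V i j y)"
      using e0 by (auto simp: exponential_density_def gpar_def indicator_def mult_ac)
    then show "ennreal (?t / p i) * ennreal (exponential_density 1 ?e
        * (exp (- w * (?e / lam i)) * V i j (?x ?e)))
      = ennreal (indicator {p i * x..} y * (gpar c lam p i * exp (- z i * (y / p i - x)) * V i j y))"
      by (metis ennreal_mult' divide_nonneg_pos less_imp_le mult_pos_pos pos)
  qed
  finally show ?thesis by (simp add: U_nn_eq)
qed

end

section \<open>The Laplace transform\<close>

lemma diag_mat_mult_nth: "(diag_mat d ** M) $ i $ j = d i * M $ i $ j"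
  by (simp add: diag_mat_def matrix_matrix_mult_def if_distrib[of "\<lambda>x. x * _"] cong: if_cong)

lemma E_mat_mult_nth: "(E_mat k ** M) $ i $ j = (if i = k then M $ i $ j else 0)"
proof -
  have "E_mat k = diag_mat (\<lambda>i. if i = k then 1 else 0)"
    by (auto simp: E_mat_def diag_mat_def vec_eq_iff)
  then show ?thesis by (simp add: diag_mat_mult_nth)
qed

lemma set_integrable_exp_mult:
  fixes h :: "real \<Rightarrow> real"
  assumes r: "r > 0" and [measurable]: "h \<in> borel_measurable borel" and h: "\<And>y. \<bar>h y\<bar> \<le> 1"
  shows "set_integrable lborel {a..} (\<lambda>y. exp (- r * y) * h y)"
proof (rule set_integrable_bound)
  have "(\<integral>\<^sup>+y. ennreal (exp (- r * y)) * indicator {a..} y \<partial>lborel) = 0 - (- exp (- r * a) / r)"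
  proof (rule nn_integral_FTC_atLeast)
    show "((\<lambda>y. - exp (- r * y) / r) has_real_derivative exp (- r * y)) (at y)" for y
      using r by (auto intro!: derivative_eq_intros)
    have "filterlim (\<lambda>y. (- r) * y) at_bot at_top"
      by (rule filterlim_tendsto_neg_mult_at_bot[OF tendsto_const _ filterlim_ident]) (use r in simp)
    then have "((\<lambda>y. - exp (- r * y) / r) \<longlongrightarrow> - 0 / r) at_top"
      by (intro tendsto_divide tendsto_minus tendsto_const filterlim_compose[OF exp_at_bot]) (use r in auto)
    then show "((\<lambda>y. - exp (- r * y) / r) \<longlongrightarrow> 0) at_top" by simp
  qed auto
  then show "set_integrable lborel {a..} (\<lambda>y. exp (- r * y))"
    unfolding set_integrable_def
    by (intro integrableI_nonneg) (auto simp: mult.commute ennreal_mult' ennreal_indicator)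
  show "AE y in lborel. y \<in> {a..} \<longrightarrow> norm (exp (- r * y) * h y) \<le> norm (exp (- r * y))"
    using h by (auto simp: abs_mult mult_left_le)
qed (auto simp: set_borel_measurable_def)

context passage_model
begin

section \<open>Entrywise Laplace transforms and their scalar recursion\<close>

definition L :: "'m \<Rightarrow> 'm \<Rightarrow> real \<Rightarrow> real" where
  "L i j s = (LINT x:{b..}|lborel. exp (- s * x) * U i j x)"

lemma integrable_L: "s > 0 \<Longrightarrow> set_integrable lborel {a..} (\<lambda>x. exp (- s * x) * U i j x)"
  by (rule set_integrable_exp_mult) (auto simp: U_nonneg U_le_1)

lemma integrable_V: "s > 0 \<Longrightarrow> set_integrable lborel {a..} (\<lambda>x. exp (- s * x) * V i j x)"
  by (rule set_integrable_exp_mult) (auto simp: V_nonneg V_le_1)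

lemma L_nonneg: "0 \<le> L i j s"
  unfolding L_def set_lebesgue_integral_def
  by (intro Bochner_Integration.integral_nonneg) (auto simp: U_nonneg)

lemma L_antimono:
  assumes "0 < s" "s \<le> r"
  shows "L i j r \<le> L i j s"
  unfolding L_def
  using assms b_pos by (intro set_integral_mono integrable_L mult_right_mono U_nonneg) auto

lemma Z_tilde_nth:
  assumes "s > 0"
  shows "Z_tilde c lam p Q w b s $ i $ j = L i j s"
proof -
  let ?f = "\<lambda>x. indicator {b..} x *\<^sub>R (exp (- s * x) *\<^sub>R Z_down c lam p Q w x b)"
  \<comment> \<open>Expansion in matrix units reduces integrability of the matrix-valued integrand
    to that of its entries; the coordinate projection can then be moved through the
    integral.\<close>
  define e :: "'m \<Rightarrow> 'm \<Rightarrow> real ^ 'm ^ 'm" where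
    "e k l = (\<chi> i j. if i = k \<and> j = l then 1 else 0)" for k l
  have "?f = (\<lambda>x. \<Sum>k\<in>UNIV. \<Sum>l\<in>UNIV. (indicator {b..} x *\<^sub>R (exp (- s * x) * U k l x)) *\<^sub>R e k l)"
  proof
    fix x
    show "?f x = (\<Sum>k\<in>UNIV. \<Sum>l\<in>UNIV. (indicator {b..} x *\<^sub>R (exp (- s * x) * U k l x)) *\<^sub>R e k l)"
    proof (simp only: vec_eq_iff, intro allI)
      fix k l
      have "(\<Sum>k'\<in>UNIV. \<Sum>l'\<in>UNIV. (indicator {b..} x *\<^sub>R (exp (- s * x) * U k' l' x)) *\<^sub>R e k' l') $ k $ l
        = (\<Sum>k'\<in>UNIV. \<Sum>l'\<in>UNIV. if l = l' then (if k = k' then indicator {b..} x *\<^sub>R (exp (- s * x) * U k' l' x) else 0) else 0)"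
        unfolding sum_component by (intro sum.cong refl) (auto simp: e_def)
      also have "\<dots> = ?f x $ k $ l"
        by (simp add: Z_down_eq_U)
      finally show "?f x $ k $ l = (\<Sum>k'\<in>UNIV. \<Sum>l'\<in>UNIV. (indicator {b..} x *\<^sub>R (exp (- s * x) * U k' l' x)) *\<^sub>R e k' l') $ k $ l"
        by (rule sym)
    qed
  qed
  then have int: "integrable lborel ?f"
    using integrable_L[OF assms, of b] unfolding set_integrable_def by simp
  have "bounded_linear (\<lambda>X :: real ^ 'm ^ 'm. X $ i $ j)"
    by (intro bounded_linear_compose[OF bounded_linear_vec_nth] bounded_linear_vec_nth)
  from integral_bounded_linear[OF this int] show ?thesis
    by (simp add: Z_tilde_def L_def set_lebesgue_integral_def Z_down_eq_U mult.assoc)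
qed

text \<open>For s \<noteq> z_i this is the integral of exp (- s x) exp (- z_i (y / p_i - x)) over x
  from b to y / p_i. Up to the denominator it is the integrand of \<open>Rb_mat\<close>.\<close>

definition kernel :: "'m \<Rightarrow> real \<Rightarrow> real \<Rightarrow> real" where
  "kernel i s y = (exp (- s * y / p i) - exp (b * (z i - s) - z i / p i * y)) / (z i - s)"

text \<open>The two exponents differ by (z_i - s) (y / p_i - b), so numerator and denominator have
  the same sign.\<close>

lemma kernel_nonneg:
  assumes "p i * b \<le> y"
  shows "0 \<le> kernel i s y"
proof -
  have "b \<le> y / p i"
    using assms p_pos[of i] by (simp add: pos_le_divide_eq mult.commute)
  then have y: "0 \<le> y / p i - b" by simp
  have diff: "- s * y / p i - (b * (z i - s) - z i / p i * y) = (z i - s) * (y / p i - b)"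
    by (simp add: algebra_simps)
  show ?thesis
  proof (cases "s \<le> z i")
    case True
    then have "b * (z i - s) - z i / p i * y \<le> - s * y / p i"
      using diff y mult_nonneg_nonneg[of "z i - s" "y / p i - b"] by linarith
    with True show ?thesis
      unfolding kernel_def by (intro divide_nonneg_nonneg) simp_all
  next
    case False
    then have "- s * y / p i \<le> b * (z i - s) - z i / p i * y"
      using diff y mult_nonpos_nonneg[of "z i - s" "y / p i - b"] by linarith
    with False show ?thesis
      unfolding kernel_def by (intro divide_nonpos_nonpos) simp_all
  qed
qed

lemma kernel_measurable [measurable]: "kernel i s \<in> borel_measurable borel"
  unfolding kernel_def[abs_def] by measurable

lemma inner_integral:
  assumes s: "s \<noteq> z i"
  shows "(\<integral>\<^sup>+x. ennreal (if b < x \<and> p i * x \<le> y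
      then exp (- s * x) * (gpar c lam p i * exp (- z i * (y / p i - x)) * V i j y) else 0) \<partial>lborel)
    = ennreal (if p i * b \<le> y then gpar c lam p i * kernel i s y * V i j y else 0)"
proof -
  let ?g = "gpar c lam p i"
  have g: "0 \<le> ?g"
    unfolding gpar_def using c_pos lam_pos p_pos by (intro divide_nonneg_nonneg mult_nonneg_nonneg) (auto simp: less_imp_le)
  have p: "p i * x \<le> y \<longleftrightarrow> x \<le> y / p i" for x
    using p_pos[of i] by (simp add: pos_le_divide_eq mult.commute)
  show ?thesis
  proof (cases "p i * b \<le> y")
    case True
    let ?d = "?g * exp (- z i * y / p i) * V i j y"
    let ?F = "\<lambda>x. exp ((z i - s) * x) / (z i - s)"
    have "(\<integral>\<^sup>+x. ennreal (if b < x \<and> p i * x \<le> y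
          then exp (- s * x) * (?g * exp (- z i * (y / p i - x)) * V i j y) else 0) \<partial>lborel)
      = (\<integral>\<^sup>+x. ennreal ?d * (ennreal (exp ((z i - s) * x)) * indicator {b..y / p i} x) \<partial>lborel)"
    proof (rule nn_integral_cong_AE)
      \<comment> \<open>Dropping the null point x = b allows the closed interval used by the
        fundamental theorem of calculus.\<close>
      have "AE x in lborel. x \<noteq> b" by (rule AE_lborel_singleton)
      then show "AE x in lborel. ennreal (if b < x \<and> p i * x \<le> y
          then exp (- s * x) * (?g * exp (- z i * (y / p i - x)) * V i j y) else 0)
        = ennreal ?d * (ennreal (exp ((z i - s) * x)) * indicator {b..y / p i} x)"
      proof eventually_elim
        case (elim x)
        have "exp (- s * x) * exp (- z i * (y / p i - x)) = exp (- z i * y / p i) * exp ((z i - s) * x)"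
          unfolding exp_add[symmetric] by (simp add: algebra_simps)
        from arg_cong[OF this, of "\<lambda>t. t * (?g * V i j y)"]
        have eq: "exp (- s * x) * (?g * exp (- z i * (y / p i - x)) * V i j y) = ?d * exp ((z i - s) * x)"
          by (simp only: mult_ac)
        have "ennreal (exp (- s * x) * (?g * exp (- z i * (y / p i - x)) * V i j y))
            = ennreal ?d * ennreal (exp ((z i - s) * x))"
          unfolding eq by (rule ennreal_mult'') simp
        then show ?case
          using elim by (auto simp: p indicator_def)
      qed
    qed
    also have "\<dots> = ennreal ?d * (\<integral>\<^sup>+x. ennreal (exp ((z i - s) * x)) * indicator {b..y / p i} x \<partial>lborel)"
      by (rule nn_integral_cmult) simp
    also have "(\<integral>\<^sup>+x. ennreal (exp ((z i - s) * x)) * indicator {b..y / p i} x \<partial>lborel)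
        = ennreal (?F (y / p i) - ?F b)"
    proof (rule nn_integral_FTC_Icc)
      show "DERIV ?F x :> exp ((z i - s) * x)" for x
        using s by (auto intro!: derivative_eq_intros)
      show "b \<le> y / p i" using True unfolding p .
    qed auto
    also have "ennreal ?d * ennreal (?F (y / p i) - ?F b) = ennreal (?d * (?F (y / p i) - ?F b))"
      using g V_nonneg by (simp add: ennreal_mult')
    also have "?d * (?F (y / p i) - ?F b) = ?g * kernel i s y * V i j y"
    proof -
      have "exp (- z i * y / p i) * exp ((z i - s) * (y / p i)) = exp (- s * y / p i)"
        "exp (- z i * y / p i) * exp ((z i - s) * b) = exp (b * (z i - s) - z i / p i * y)"
        unfolding exp_add[symmetric] by (simp_all add: algebra_simps)
      then have "exp (- z i * y / p i) * (?F (y / p i) - ?F b) = kernel i s y"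
        unfolding kernel_def diff_divide_distrib right_diff_distrib times_divide_eq_right by simp
      from arg_cong[OF this, of "\<lambda>t. t * (?g * V i j y)"] show ?thesis
        by (simp only: mult_ac)
    qed
    finally show ?thesis using True by simp
  next
    case False
    then have "(b < x \<and> p i * x \<le> y) = False" for x
      using mult_strict_left_mono[OF _ p_pos, of b x i] by auto
    then have "(\<integral>\<^sup>+x. ennreal (if b < x \<and> p i * x \<le> y
          then exp (- s * x) * (?g * exp (- z i * (y / p i - x)) * V i j y) else 0) \<partial>lborel) = 0"
      by (simp only: if_False) simp
    with False show ?thesis by simp
  qed
qed

text \<open>The renewal equation is inserted under the transform and the order of integration is
  exchanged; as everything is nonnegative, this takes place in \<open>ennreal\<close>. The renewal
  equation requires x > b, hence the exclusion of the null point x = b.\<close>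

lemma L_eq_kernel_integral:
  assumes s: "s > 0" "s \<noteq> z i"
  shows "L i j s = (LINT y:{p i * b..}|lborel. gpar c lam p i * kernel i s y * V i j y)"
proof -
  let ?h = "\<lambda>x y. if b < x \<and> p i * x \<le> y
      then exp (- s * x) * (gpar c lam p i * exp (- z i * (y / p i - x)) * V i j y) else 0"
  have g: "0 \<le> gpar c lam p i"
    unfolding gpar_def using c_pos lam_pos p_pos by (intro divide_nonneg_nonneg mult_nonneg_nonneg) (auto simp: less_imp_le)
  have "ennreal (L i j s) = (\<integral>\<^sup>+x. ennreal (indicator {b..} x *\<^sub>R (exp (- s * x) * U i j x)) \<partial>lborel)"
    unfolding L_def set_lebesgue_integral_def
    by (rule nn_integral_eq_integral[symmetric])
       (use integrable_L[OF s(1), of b] in \<open>auto simp: set_integrable_def U_nonneg\<close>)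
  also have "\<dots> = (\<integral>\<^sup>+x. \<integral>\<^sup>+y. ennreal (?h x y) \<partial>lborel \<partial>lborel)"
  proof (rule nn_integral_cong_AE)
    have "AE x in lborel. x \<noteq> b" by (rule AE_lborel_singleton)
    then show "AE x in lborel. ennreal (indicator {b..} x *\<^sub>R (exp (- s * x) * U i j x))
        = (\<integral>\<^sup>+y. ennreal (?h x y) \<partial>lborel)"
    proof eventually_elim
      case (elim x)
      show ?case
      proof (cases "b < x")
        case True
        have "(\<integral>\<^sup>+y. ennreal (?h x y) \<partial>lborel) = (\<integral>\<^sup>+y. ennreal (exp (- s * x)) *
            ennreal (indicator {p i * x..} y * (gpar c lam p i * exp (- z i * (y / p i - x)) * V i j y)) \<partial>lborel)"
          using True by (intro nn_integral_cong) (auto simp: indicator_def ennreal_mult')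
        also have "\<dots> = ennreal (exp (- s * x)) * ennreal (U i j x)"
          unfolding first_step[OF True] by (rule nn_integral_cmult) measurable
        finally show ?thesis using True by (simp add: ennreal_mult')
      qed (use elim in simp)
    qed
  qed
  also have "\<dots> = (\<integral>\<^sup>+y. \<integral>\<^sup>+x. ennreal (?h x y) \<partial>lborel \<partial>lborel)"
    by (rule lborel_pair.Fubini'[symmetric]) measurable
  also have "\<dots> = (\<integral>\<^sup>+y. ennreal (indicator {p i * b..} y *\<^sub>R (gpar c lam p i * kernel i s y * V i j y)) \<partial>lborel)"
    unfolding inner_integral[OF s(2)] by (intro nn_integral_cong) (auto simp: indicator_def)
  finally have "ennreal (L i j s) = \<dots>" .
  \<comment> \<open>For a nonnegative measurable integrand the real integral is
    \<open>enn2real\<close> of the extended one, and the latter is the finite value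
    \<open>ennreal (L i j s)\<close>.\<close>
  moreover have "(LINT y:{p i * b..}|lborel. gpar c lam p i * kernel i s y * V i j y)
    = enn2real (\<integral>\<^sup>+y. ennreal (indicator {p i * b..} y *\<^sub>R (gpar c lam p i * kernel i s y * V i j y)) \<partial>lborel)"
    unfolding set_lebesgue_integral_def
    by (rule integral_eq_nn_integral)
       (auto simp: indicator_def g V_nonneg kernel_nonneg)
  ultimately show ?thesis
    by (metis enn2real_ennreal L_nonneg)
qed

lemma V_below: "y \<le> b \<Longrightarrow> V i j y = Q $ i $ j"
  by (simp add: V_def U_below if_distrib[of "\<lambda>x. _ * x"] cong: if_cong)

lemma integral_V_above:
  assumes "s > 0"
  shows "(LINT y:{b..}|lborel. exp (- s * y) * V i j y) = (\<Sum>k\<in>UNIV. Q $ i $ k * L k j s)"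
proof -
  have "(LINT y:{b..}|lborel. exp (- s * y) * V i j y)
      = (\<integral>y. (\<Sum>k\<in>UNIV. Q $ i $ k * (indicator {b..} y *\<^sub>R (exp (- s * y) * U k j y))) \<partial>lborel)"
    unfolding set_lebesgue_integral_def V_def
    by (intro Bochner_Integration.integral_cong) (auto simp: sum_distrib_left mult_ac)
  also have "\<dots> = (\<Sum>k\<in>UNIV. Q $ i $ k * L k j s)"
    using integrable_L[OF assms, of b]
    by (subst Bochner_Integration.integral_sum) (auto simp: set_integrable_def L_def set_lebesgue_integral_def)
  finally show ?thesis .
qed

text \<open>Split the kernel integral at y = b. Below b, \<open>V\<close> is the constant entry of
  \<open>Q\<close> and yields the \<open>Rb_mat\<close> term; above b, the two exponentials of the
  kernel are transforms at s / p_i and at z_i / p_i.\<close>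

lemma L_recursion:
  assumes s: "s > 0" "s \<noteq> z i"
  shows "L i j s = gpar c lam p i / (z i - s) *
    (Rb_mat c lam p w b s $ i $ i * Q $ i $ j + (\<Sum>k\<in>UNIV. Q $ i $ k * L k j (s / p i))
      - exp (b * (z i - s)) * (\<Sum>k\<in>UNIV. Q $ i $ k * L k j (z i / p i)))"
proof -
  let ?k = "\<lambda>y. exp (- s * y / p i) - exp (b * (z i - s) - z i / p i * y)"
  let ?f = "\<lambda>y. ?k y * V i j y"
  have p: "0 < p i" "p i * b \<le> b" using p_pos p_less_1[of i] b_pos by auto
  have f: "?f y = exp (- (s / p i) * y) * V i j y - exp (b * (z i - s)) * (exp (- (z i / p i) * y) * V i j y)" for y
  proof -
    have "exp (b * (z i - s) - z i / p i * y) = exp (b * (z i - s)) * exp (- (z i / p i) * y)"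
      unfolding exp_add[symmetric] by simp
    then show ?thesis by (simp add: left_diff_distrib)
  qed
  have pos: "0 < s / p i" "0 < z i / p i" using s p z_pos by auto
  have int: "set_integrable lborel {a..} ?f" for a
    unfolding f by (intro set_integral_diff set_integrable_mult_right integrable_V pos)
  have split: "{p i * b..} = {p i * b..b} \<union> {b..}" using p by auto
  have "AE y in lborel. y \<noteq> b" by (rule AE_lborel_singleton)
  then have "(LINT y:{p i * b..}|lborel. ?f y) = (LINT y:{p i * b..b}|lborel. ?f y) + (LINT y:{b..}|lborel. ?f y)"
    unfolding split
    by (intro set_integral_Un_AE int set_integrable_subset[OF int[of "p i * b"]])
       (auto elim!: eventually_mono)
  also have "(LINT y:{p i * b..b}|lborel. ?f y) = (LINT y:{p i * b..b}|lborel. ?k y * Q $ i $ j)"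
    by (rule set_lebesgue_integral_cong) (auto simp: V_below)
  also have "\<dots> = Rb_mat c lam p w b s $ i $ i * Q $ i $ j"
    by (simp add: Rb_mat_def diag_mat_def)
  also have "(LINT y:{b..}|lborel. ?f y) = (\<Sum>k\<in>UNIV. Q $ i $ k * L k j (s / p i))
      - exp (b * (z i - s)) * (\<Sum>k\<in>UNIV. Q $ i $ k * L k j (z i / p i))"
    unfolding f
    by (subst set_integral_diff(2))
       (auto simp: integral_V_above[OF pos(1), simplified] integral_V_above[OF pos(2), simplified]
          intro!: integrable_V[OF pos(1), simplified] integrable_V[OF pos(2), simplified])
  finally have I: "(LINT y:{p i * b..}|lborel. ?f y) = Rb_mat c lam p w b s $ i $ i * Q $ i $ j +
     ((\<Sum>k\<in>UNIV. Q $ i $ k * L k j (s / p i))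
      - exp (b * (z i - s)) * (\<Sum>k\<in>UNIV. Q $ i $ k * L k j (z i / p i)))" .
  have "L i j s = (LINT y:{p i * b..}|lborel. gpar c lam p i / (z i - s) * ?f y)"
    unfolding L_eq_kernel_integral[OF s] by (rule set_lebesgue_integral_cong) (simp_all add: kernel_def)
  also have "\<dots> = gpar c lam p i / (z i - s) * (LINT y:{p i * b..}|lborel. ?f y)"
    by (rule set_integral_mult_right)
  finally show ?thesis unfolding I by simp
qed

section \<open>The matrix recursion, its resolvent solution, and continuity in s\<close>

abbreviation "Zt \<equiv> Z_tilde c lam p Q w b"

abbreviation "Hb \<equiv> H_mat c lam p Q w b"

lemma H_mat_nth: "Hb $ i $ j = - exp (z i * b) * (\<Sum>k\<in>UNIV. Q $ i $ k * L k j (z i / p i))"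
proof -
  have zp: "0 < z k / p k" for k using z_pos p_pos by simp
  have "(\<Sum>k\<in>UNIV. exp (z k * b) *\<^sub>R (E_mat k ** Q ** Zt (z k / p k))) $ i $ j
    = (\<Sum>k\<in>UNIV. if i = k then exp (z k * b) * (Q ** Zt (z k / p k)) $ i $ j else 0)"
    unfolding sum_component by (intro sum.cong refl) (auto simp: E_mat_mult_nth matrix_mul_assoc[symmetric])
  also have "\<dots> = exp (z i * b) * (\<Sum>k\<in>UNIV. Q $ i $ k * L k j (z i / p i))"
    by (simp add: matrix_matrix_mult_def Z_tilde_nth[OF zp])
  finally show ?thesis by (simp add: H_mat_def)
qed

lemma Z_tilde_recursion:
  assumes s: "s > 0" "\<And>i. s \<noteq> z i"
  shows "Zt s = AF_mat c lam p Q w b Hb s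
    + (\<Sum>i\<in>UNIV. A_mat c lam p w s ** E_mat i ** Q ** Zt (s / p i))"
proof (simp only: vec_eq_iff, intro allI)
  fix i j
  have sp: "0 < s / p k" for k using s p_pos by simp
  have "(\<Sum>k\<in>UNIV. A_mat c lam p w s ** E_mat k ** Q ** Zt (s / p k)) $ i $ j
    = (\<Sum>k\<in>UNIV. if i = k then gpar c lam p i / (z i - s) * (Q ** Zt (s / p k)) $ i $ j else 0)"
    unfolding sum_component
    by (intro sum.cong refl) (auto simp: A_mat_def diag_mat_mult_nth E_mat_mult_nth matrix_mul_assoc[symmetric])
  then have sum: "(\<Sum>k\<in>UNIV. A_mat c lam p w s ** E_mat k ** Q ** Zt (s / p k)) $ i $ j
    = gpar c lam p i / (z i - s) * (\<Sum>k\<in>UNIV. Q $ i $ k * L k j (s / p i))"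
    by (simp add: matrix_matrix_mult_def Z_tilde_nth[OF sp])
  \<comment> \<open>This factorization separates the dependence on s from the constant absorbed in
    row i of \<open>Hb\<close>.\<close>
  have "exp (b * (z i - s)) = exp (- b * s) * exp (z i * b)"
    unfolding exp_add[symmetric] by (simp add: algebra_simps)
  moreover have "(Rb_mat c lam p w b s ** Q) $ i $ j = Rb_mat c lam p w b s $ i $ i * Q $ i $ j"
    unfolding Rb_mat_def diag_mat_mult_nth by (simp add: diag_mat_def)
  ultimately have "AF_mat c lam p Q w b Hb s $ i $ j = gpar c lam p i / (z i - s) *
      (Rb_mat c lam p w b s $ i $ i * Q $ i $ j
      - exp (b * (z i - s)) * (\<Sum>k\<in>UNIV. Q $ i $ k * L k j (z i / p i)))"
    by (simp add: AF_mat_def A_mat_def diag_mat_mult_nth F_mat_def H_mat_nth)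
  then show "Zt s $ i $ j = (AF_mat c lam p Q w b Hb s
    + (\<Sum>i\<in>UNIV. A_mat c lam p w s ** E_mat i ** Q ** Zt (s / p i))) $ i $ j"
    unfolding vector_add_component sum Z_tilde_nth[OF s(1)] L_recursion[OF s]
    by (simp add: algebra_simps)
qed

lemma word_weight_bounds: "0 < word_weight p \<alpha> \<and> word_weight p \<alpha> \<le> 1"
proof (induction \<alpha>)
  case (Cons i \<alpha>)
  then have "p i * word_weight p \<alpha> \<le> 1"
    using p_pos[of i] p_less_1[of i] by (intro mult_le_one) auto
  with Cons show ?case by (simp add: word_weight_def p_pos)
qed (simp add: word_weight_Nil)

text \<open>Monotonicity of the transforms gives one bound on [s, \<infinity>), which contains every
  s / p_\<alpha>; this is the uniform bound that the iteration uses.\<close>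

lemma norm_Z_tilde_le:
  assumes "0 < s" "s \<le> r"
  shows "norm (Zt r) \<le> (\<Sum>i\<in>UNIV. \<Sum>j\<in>UNIV. L i j s)"
proof -
  have r: "0 < r" using assms by simp
  have "norm (Zt r) \<le> (\<Sum>i\<in>UNIV. norm (Zt r $ i))"
    unfolding norm_vec_def[of "Zt r"] by (rule L2_set_le_sum) simp
  also have "\<dots> \<le> (\<Sum>i\<in>UNIV. \<Sum>j\<in>UNIV. \<bar>Zt r $ i $ j\<bar>)"
    by (intro sum_mono norm_le_l1_cart)
  also have "\<dots> \<le> (\<Sum>i\<in>UNIV. \<Sum>j\<in>UNIV. L i j s)"
    by (intro sum_mono) (simp add: Z_tilde_nth[OF r] L_nonneg L_antimono[OF assms])
  finally show ?thesis .
qed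

text \<open>An orbit point s / p_\<alpha> equals z_i exactly when s = z_i p_\<alpha>. Outside
  \<open>pole_set\<close> the recursion therefore holds along the whole orbit.\<close>

lemma Z_tilde_resolvent:
  assumes s: "s > 0" "s \<notin> pole_set c lam p w"
  shows "(\<lambda>\<alpha>. norm (R_term c lam p Q w (AF_mat c lam p Q w b Hb) s \<alpha>)) summable_on X"
    and "Zt s = R_op c lam p Q w (AF_mat c lam p Q w b Hb) s"
proof -
  have rec: "Zt r = AF_mat c lam p Q w b Hb r
      + (\<Sum>i\<in>UNIV. A_mat c lam p w r ** E_mat i ** Q ** Zt (r / p i))"
    if r: "r = s / word_weight p \<alpha>" for \<alpha> r
  proof (rule Z_tilde_recursion)
    have ww: "0 < word_weight p \<alpha>" using word_weight_bounds by blast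
    then show "0 < r" using s r by simp
    show "r \<noteq> z i" for i
    proof
      assume "r = z i"
      then have "s = z i * word_weight p \<alpha>" using r ww by (simp add: field_simps)
      then show False using s(2) by (auto simp: pole_set_def)
    qed
  qed
  have "s \<le> s / word_weight p \<alpha>" for \<alpha>
    using word_weight_bounds[of \<alpha>] s(1) by (simp add: pos_le_divide_eq mult_left_le)
  note bound = norm_Z_tilde_le[OF s(1) this]
  show "(\<lambda>\<alpha>. norm (R_term c lam p Q w (AF_mat c lam p Q w b Hb) s \<alpha>)) summable_on X"
    and "Zt s = R_op c lam p Q w (AF_mat c lam p Q w b Hb) s"
    by (rule resolvent_iteration[where Z=Zt and G="AF_mat c lam p Q w b Hb", OF p_pos p_less_1 s(1) _ bound], erule rec)+
qed

text \<open>Dominated convergence: arguments close to s eventually exceed s / 2, so the integrand at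
  s / 2 dominates on x \<ge> b > 0.\<close>

lemma L_continuous:
  assumes s: "s > 0"
  shows "(L i j \<longlongrightarrow> L i j s) (at s within X)"
  unfolding tendsto_at_iff_sequentially comp_def
proof (intro allI impI)
  fix r :: "nat \<Rightarrow> real"
  assume r: "r \<longlonglongrightarrow> s"
  obtain N where N: "\<And>n. N \<le> n \<Longrightarrow> s / 2 < r n"
    using order_tendstoD(1)[OF r, of "s / 2"] s by (auto simp: eventually_sequentially)
  have r': "(\<lambda>n. r (n + N)) \<longlonglongrightarrow> s" by (rule LIMSEQ_ignore_initial_segment[OF r])
  have "(\<lambda>n. L i j (r (n + N))) \<longlonglongrightarrow> L i j s"
    unfolding L_def set_lebesgue_integral_def
  proof (rule integral_dominated_convergence[where w="\<lambda>x. indicator {b..} x *\<^sub>R (exp (- (s / 2) * x) * U i j x)"])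
    show "integrable lborel (\<lambda>x. indicator {b..} x *\<^sub>R (exp (- (s / 2) * x) * U i j x))"
      using integrable_L[of "s / 2" b] s by (simp add: set_integrable_def)
    show "AE x in lborel. (\<lambda>n. indicator {b..} x *\<^sub>R (exp (- r (n + N) * x) * U i j x))
        \<longlonglongrightarrow> indicator {b..} x *\<^sub>R (exp (- s * x) * U i j x)"
      by (intro AE_I2 tendsto_intros r')
    show "AE x in lborel. norm (indicator {b..} x *\<^sub>R (exp (- r (n + N) * x) * U i j x))
        \<le> indicator {b..} x *\<^sub>R (exp (- (s / 2) * x) * U i j x)" for n
    proof (rule AE_I2)
      fix x
      have "exp (- r (n + N) * x) * U i j x \<le> exp (- (s / 2) * x) * U i j x" if "b \<le> x"
        using that b_pos N[of "n + N"] by (intro mult_right_mono U_nonneg) auto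
      then show "norm (indicator {b..} x *\<^sub>R (exp (- r (n + N) * x) * U i j x))
        \<le> indicator {b..} x *\<^sub>R (exp (- (s / 2) * x) * U i j x)"
        by (auto simp: indicator_def U_nonneg)
    qed
  qed auto
  then show "(\<lambda>n. L i j (r n)) \<longlonglongrightarrow> L i j s" by (rule LIMSEQ_offset)
qed

lemma Z_tilde_continuous:
  assumes s: "s > 0" and X: "X \<subseteq> {0<..}"
  shows "(Zt \<longlongrightarrow> Zt s) (at s within X)"
proof (intro vec_tendstoI)
  fix i j
  have "\<forall>\<^sub>F r in at s within X. L i j r = Zt r $ i $ j"
    using X by (auto simp: eventually_at_filter Z_tilde_nth subset_iff)
  then show "((\<lambda>r. Zt r $ i $ j) \<longlongrightarrow> Zt s $ i $ j) (at s within X)"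
    unfolding Z_tilde_nth[OF s] by (rule Lim_transform_eventually[OF L_continuous[OF s]])
qed

end

section \<open>The identity off the poles, compatibility of \<open>H_mat\<close>, and limits at the
  poles\<close>

theorem theorem4p1:
  fixes c lam p :: "'m::finite \<Rightarrow> real" and Q :: "real ^ 'm ^ 'm" and w b :: real
  assumes "\<And>i. c i > 0" and "\<And>i. lam i > 0" and "\<And>i. 0 < p i \<and> p i < 1"
    and "stochastic_matrix Q" and "w > 0" and "b > 0"
  shows
    "(\<forall>s. s > 0 \<and> s \<notin> pole_set c lam p w \<longrightarrow>
        (\<lambda>\<alpha>. norm (R_term c lam p Q w (AF_mat c lam p Q w b (H_mat c lam p Q w b)) s \<alpha>))
          summable_on {\<alpha>. \<alpha> \<noteq> []} \<and>
        Z_tilde c lam p Q w b s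
          = R_op c lam p Q w (AF_mat c lam p Q w b (H_mat c lam p Q w b)) s) \<and>
     ((\<forall>i. zpar c lam w i / p i \<notin> pole_set c lam p w) \<longrightarrow>
        H_mat c lam p Q w b = C_map c lam p Q w b (H_mat c lam p Q w b)) \<and>
     (\<forall>s \<in> pole_set c lam p w.
        (R_op c lam p Q w (AF_mat c lam p Q w b (H_mat c lam p Q w b))
           \<longlongrightarrow> Z_tilde c lam p Q w b s)
          (at s within {r. r > 0 \<and> r \<notin> pole_set c lam p w}))"
proof -
  interpret passage_model c lam p Q w b
    by unfold_locales (use assms in auto)
  let ?P = "pole_set c lam p w" and ?R = "R_op c lam p Q w (AF_mat c lam p Q w b Hb)"
  have "Hb = C_map c lam p Q w b Hb" if "\<forall>i. z i / p i \<notin> ?P"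
  proof -
    \<comment> \<open>The points z_i / p_i are positive and assumed to avoid the poles, so the
      resolvent identity holds there and turns the definition of \<open>Hb\<close> into the
      fixed-point equation.\<close>
    have eq: "Zt (z i / p i) = ?R (z i / p i)" for i
      using that z_pos p_pos by (intro Z_tilde_resolvent) auto
    show ?thesis
      unfolding C_map_def Z_tilde_H_def eq[symmetric] by (rule H_mat_def)
  qed
  moreover have "(?R \<longlongrightarrow> Zt s) (at s within {r. r > 0 \<and> r \<notin> ?P})" if "s \<in> ?P" for s
  proof (rule Lim_transform_eventually[OF Z_tilde_continuous])
    show "0 < s"
      using that z_pos word_weight_bounds by (auto simp: pole_set_def intro!: mult_pos_pos)
    show "\<forall>\<^sub>F r in at s within {r. r > 0 \<and> r \<notin> ?P}. Zt r = ?R r"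
      by (auto simp: eventually_at_filter intro!: always_eventually Z_tilde_resolvent)
  qed auto
  ultimately show ?thesis
    using Z_tilde_resolvent by blast
qed

end
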